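(* There are absolute constants $C,a>0$ such that for every $d\ge1$ and every $\epsilon\in(0,1/2]$ there exists a two-sided, adaptive $(\epsilon,\ell_2)$-tester for real symmetric $d\times d$ matrices in the vector-matrix-vector model that makes at most $C\,\frac{1}{\epsilon^2}\log^a\frac1\epsilon$ queries.
   Context: For a real symmetric matrix $A$, $\|A\|_p$ denotes the Schatten-$p$ norm (the $\ell_p$ norm of the vector of singular values; $\|A\|_2$ is the Frobenius norm), and $\lambda_{\min}(A)$ its smallest eigenvalue. PSD means positive semidefinite. A randomized algorithm has access to an unknown real symmetric $d\times d$ matrix $A$ only through vector-matrix-vector queries: it chooses $v,w\in\mathbb{R}^d$ and receives $v^TAw$. It is adaptive if queries may depend on previous answers (and on the algorithm's random coins). Computation is otherwise free; the number of queries is counted in the worst case over inputs and coins. For $p\in[1,\infty]$ and $\epsilon\in(0,1)$, an $(\epsilon,\ell_p)$-tester is such an algorithm that outputs True with probability at least $2/3$ if $A$ is PSD, and outputs False with probability at least $2/3$ if $A\neq 0$ and $\lambda_{\min}(A)\le-\epsilon\|A\|_p$. "Two-sided" means that errors are allowed on both PSD and non-PSD inputs. *)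

theory Defs
  imports "HOL-Probability.Probability" "Jordan_Normal_Form.Spectral_Radius"
begin

section \<open>Real symmetric matrices\<close>

definition symmetric_mats :: "nat \<Rightarrow> real mat set" where
  "symmetric_mats d = {A \<in> carrier_mat d d. transpose_mat A = A}"

definition psd :: "real mat \<Rightarrow> bool" where
  "psd A \<longleftrightarrow> transpose_mat A = A \<and>
     (\<forall>x \<in> carrier_vec (dim_row A). scalar_prod x (A *\<^sub>v x) \<ge> 0)"

definition lambda_min :: "real mat \<Rightarrow> real" where
  "lambda_min A = Min (spectrum A)"

text \<open>Singular values with multiplicity. All roots of the characteristic polynomial of
  \<open>A\<^sup>T A\<close> are real and nonnegative, so the real roots account for the full multiset.\<close>

definition singular_values :: "real mat \<Rightarrow> real multiset" where
  "singular_values A = image_mset sqrt (proots (char_poly (transpose_mat A * A)))"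

definition schatten_norm :: "ereal \<Rightarrow> real mat \<Rightarrow> real" where
  "schatten_norm p A =
     (if p = \<infinity> then Max (set_mset (singular_values A))
      else (\<Sum>\<sigma>\<in>#singular_values A. \<sigma> powr real_of_ereal p) powr (1 / real_of_ereal p))"

section \<open>Vector-matrix-vector query algorithms\<close>

text \<open>A deterministic adaptive algorithm is a decision tree, branching on the real-valued answer
  to each query. As an inductive datatype the trees are well-founded, so every run terminates.\<close>

datatype vmv_alg = Output bool | Query "real vec" "real vec" "real \<Rightarrow> vmv_alg"

primrec valid_queries :: "nat \<Rightarrow> vmv_alg \<Rightarrow> bool" where
  "valid_queries d (Output b) \<longleftrightarrow> True"
| "valid_queries d (Query v w k) \<longleftrightarrow>
     v \<in> carrier_vec d \<and> w \<in> carrier_vec d \<and> (\<forall>r. valid_queries d (k r))"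

primrec accepts :: "real mat \<Rightarrow> vmv_alg \<Rightarrow> bool" where
  "accepts A (Output b) \<longleftrightarrow> b"
| "accepts A (Query v w k) \<longleftrightarrow> accepts A (k (scalar_prod v (A *\<^sub>v w)))"

primrec num_queries :: "real mat \<Rightarrow> vmv_alg \<Rightarrow> nat" where
  "num_queries A (Output b) = 0"
| "num_queries A (Query v w k) = Suc (num_queries A (k (scalar_prod v (A *\<^sub>v w))))"

text \<open>A randomized algorithm draws its coins \<open>\<omega>\<close>, an infinite tape of reals with some Borel
  probability law \<open>M\<close>, and then runs the decision tree \<open>T \<omega>\<close>. The law of the coins is part of the
  algorithm, hence independent of the input matrix. For every input the output must be a random
  variable.\<close>

type_synonym coins = "nat \<Rightarrow> real"

definition randomized_vmv_alg :: "nat \<Rightarrow> coins measure \<Rightarrow> (coins \<Rightarrow> vmv_alg) \<Rightarrow> bool" where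
  "randomized_vmv_alg d M T \<longleftrightarrow>
     prob_space M \<and> sets M = sets (PiM UNIV (\<lambda>_. borel)) \<and>
     (\<forall>\<omega> \<in> space M. valid_queries d (T \<omega>)) \<and>
     (\<forall>A \<in> symmetric_mats d. (\<lambda>\<omega>. accepts A (T \<omega>)) \<in> measurable M (count_space UNIV))"

definition at_most_queries :: "nat \<Rightarrow> coins measure \<Rightarrow> (coins \<Rightarrow> vmv_alg) \<Rightarrow> real \<Rightarrow> bool" where
  "at_most_queries d M T q \<longleftrightarrow>
     (\<forall>\<omega> \<in> space M. \<forall>A \<in> symmetric_mats d. real (num_queries A (T \<omega>)) \<le> q)"

definition psd_tester ::
    "real \<Rightarrow> ereal \<Rightarrow> nat \<Rightarrow> coins measure \<Rightarrow> (coins \<Rightarrow> vmv_alg) \<Rightarrow> bool" where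
  "psd_tester \<epsilon> p d M T \<longleftrightarrow>
     randomized_vmv_alg d M T \<and>
     (\<forall>A \<in> symmetric_mats d.
        (psd A \<longrightarrow> measure M {\<omega> \<in> space M. accepts A (T \<omega>)} \<ge> 2 / 3) \<and>
        (A \<noteq> 0\<^sub>m d d \<and> lambda_min A \<le> - \<epsilon> * schatten_norm p A \<longrightarrow>
           measure M {\<omega> \<in> space M. \<not> accepts A (T \<omega>)} \<ge> 2 / 3))"

end

theory Submission
  imports Defs
begin

text \<open>
  Let \<open>F\<close> be the Frobenius norm of \<open>A\<close>, draw sign vectors \<open>g\<^sub>1, \<dots>, g\<^sub>n\<close> and let \<open>P\<close> be the product of
  the matrices \<open>1 - \<eta> g\<^sub>t g\<^sub>t\<^sup>T A\<close>. Computing \<open>h\<^sup>T A P x\<close> takes \<open>n + 1\<close> queries. One step changes the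
  expectation of \<open>|A x|\<^sup>2\<close> by \<open>- 2 \<eta> (A x)\<^sup>T A (A x)\<close> plus at most \<open>3 \<eta>\<^sup>2 F\<^sup>2 |A x|\<^sup>2\<close>. If \<open>A\<close> is positive
  semidefinite, the first term is not positive, so for \<open>\<eta>\<^sup>2 F\<^sup>2 n\<close> below a small constant the expected
  Frobenius norm of \<open>A P\<close> remains comparable to \<open>F\<close>. If \<open>A v = - l v\<close> for a unit vector \<open>v\<close> and
  \<open>l = - \<lambda>\<^sub>m\<^sub>i\<^sub>n\<close>, then \<open>v\<^sup>T P v\<close> has mean \<open>(1 + \<eta> l)\<^sup>n\<close>, and the same second moment bound shows that it
  is concentrated. For \<open>l \<ge> \<epsilon> F\<close> and \<open>n\<close> of order \<open>log\<^sup>2 (1/\<epsilon>) / \<epsilon>\<^sup>2\<close> this makes the norm of \<open>A P\<close> exceed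
  \<open>F\<close> by a large constant factor. Averaging \<open>(h\<^sup>T B g)\<^sup>2\<close> over independent sign vectors \<open>g, h\<close> estimates
  the squared Frobenius norm of \<open>B\<close>, for \<open>B = A\<close> as well as for \<open>B = A P\<close>.
\<close>

section \<open>Vectors and matrices as functions\<close>

definition ip :: "nat \<Rightarrow> (nat \<Rightarrow> real) \<Rightarrow> (nat \<Rightarrow> real) \<Rightarrow> real" where
  "ip d x y = (\<Sum>i<d. x i * y i)"

definition mv :: "nat \<Rightarrow> (nat \<Rightarrow> nat \<Rightarrow> real) \<Rightarrow> (nat \<Rightarrow> real) \<Rightarrow> nat \<Rightarrow> real" where
  "mv d A x = (\<lambda>i. \<Sum>j<d. A i j * x j)"

definition frob2 :: "nat \<Rightarrow> (nat \<Rightarrow> nat \<Rightarrow> real) \<Rightarrow> real" where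
  "frob2 d A = (\<Sum>i<d. \<Sum>j<d. (A i j)\<^sup>2)"

lemma ip_commute: "ip d x y = ip d y x"
  by (simp add: ip_def mult.commute)

lemma ip_diff_scaled: "ip d v (\<lambda>i. x i - c * y i) = ip d v x - c * ip d v y"
  by (simp add: ip_def algebra_simps sum_subtractf sum_distrib_left)

lemma ip_diff_scaled_self:
  "ip d (\<lambda>i. x i - c * y i) (\<lambda>i. x i - c * y i) = ip d x x - 2 * c * ip d x y + c\<^sup>2 * ip d y y"
  by (simp add: ip_def algebra_simps power2_eq_square sum.distrib sum_subtractf sum_distrib_left)

lemma mv_diff_scaled: "mv d A (\<lambda>i. x i - c * y i) = (\<lambda>i. mv d A x i - c * mv d A y i)"
  by (simp add: mv_def algebra_simps sum_subtractf sum_distrib_left)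

lemma mv_eq_ip: "mv d A x i = ip d (A i) x"
  by (simp add: mv_def ip_def)

lemma ip_self_nonneg: "0 \<le> ip d x x"
  by (simp add: ip_def sum_nonneg)

lemma ip_Cauchy_Schwarz: "(ip d x y)\<^sup>2 \<le> ip d x x * ip d y y"
  using Cauchy_Schwarz_ineq_sum[of x y "{..<d}"] by (simp add: ip_def power2_eq_square)

lemma ip_mv_symmetric:
  assumes "\<And>i j. i < d \<Longrightarrow> j < d \<Longrightarrow> A i j = A j i"
  shows "ip d (mv d A x) y = ip d x (mv d A y)"
proof -
  have "ip d (mv d A x) y = (\<Sum>i<d. \<Sum>j<d. A i j * x j * y i)"
    by (simp add: ip_def mv_def sum_distrib_right)
  also have "\<dots> = (\<Sum>j<d. \<Sum>i<d. A i j * x j * y i)"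
    by (rule sum.swap)
  also have "\<dots> = (\<Sum>j<d. \<Sum>i<d. x j * (A j i * y i))"
    by (intro sum.cong refl) (simp add: assms)
  also have "\<dots> = ip d x (mv d A y)"
    by (simp add: ip_def mv_def sum_distrib_left)
  finally show ?thesis .
qed

lemma frob2_nonneg: "0 \<le> frob2 d A"
  by (simp add: frob2_def sum_nonneg)

lemma frob2_eq_sum_ip: "frob2 d A = (\<Sum>i<d. ip d (A i) (A i))"
  by (simp add: frob2_def ip_def power2_eq_square)

text \<open>The operator norm is at most the Frobenius norm, by Cauchy-Schwarz in each row.\<close>

lemma ip_mv_self_le: "ip d (mv d A x) (mv d A x) \<le> frob2 d A * ip d x x"
proof -
  have "ip d (mv d A x) (mv d A x) = (\<Sum>i<d. (ip d (A i) x)\<^sup>2)"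
    by (simp add: ip_def mv_def power2_eq_square)
  also have "\<dots> \<le> (\<Sum>i<d. ip d (A i) (A i) * ip d x x)"
    by (intro sum_mono ip_Cauchy_Schwarz)
  finally show ?thesis
    by (simp add: frob2_eq_sum_ip sum_distrib_right)
qed

section \<open>The spectral theorem for real symmetric matrices\<close>

lemma ip_cong: "(\<And>i. i < d \<Longrightarrow> x i = x' i) \<Longrightarrow> (\<And>i. i < d \<Longrightarrow> y i = y' i) \<Longrightarrow> ip d x y = ip d x' y'"
  by (simp add: ip_def)

lemma mv_cong: "(\<And>i. i < d \<Longrightarrow> x i = x' i) \<Longrightarrow> mv d A x = mv d A x'"
  by (simp add: mv_def)

lemma ip_self_eq_0: "ip d x x = 0 \<Longrightarrow> i < d \<Longrightarrow> x i = 0"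
  by (simp add: ip_def sum_nonneg_eq_0_iff)

lemma ip_scale: "ip d (\<lambda>i. c * x i) y = c * ip d x y" "ip d x (\<lambda>i. c * y i) = c * ip d x y"
  by (simp_all add: ip_def sum_distrib_left mult_ac)

lemma mv_scale: "mv d A (\<lambda>i. c * x i) = (\<lambda>i. c * mv d A x i)"
  by (simp add: mv_def sum_distrib_left mult_ac)

lemma ip_sum_right: "ip d x (\<lambda>j. \<Sum>i\<in>I. f i j) = (\<Sum>i\<in>I. ip d x (f i))"
  unfolding ip_def sum_distrib_left by (rule sum.swap)

lemma ip_basis_vector: "j < d \<Longrightarrow> ip d x (\<lambda>m. if m = j then 1 else 0) = x j"
  by (simp add: ip_def mult_delta_right)

lemma continuous_on_ip:
  assumes "\<And>i. i < d \<Longrightarrow> continuous_on S (\<lambda>x. f x i)" "\<And>i. i < d \<Longrightarrow> continuous_on S (\<lambda>x. g x i)"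
  shows "continuous_on S (\<lambda>x. ip d (f x) (g x))"
  unfolding ip_def using assms by (intro continuous_on_sum continuous_on_mult) auto

lemma continuous_on_coordinate: "continuous_on S (\<lambda>x. x i :: real)"
  by (rule continuous_on_subset[OF continuous_on_product_coordinates]) simp

section \<open>Orthonormal systems and the construction of an eigenbasis\<close>

definition orthonormal :: "nat \<Rightarrow> nat \<Rightarrow> (nat \<Rightarrow> nat \<Rightarrow> real) \<Rightarrow> bool" where
  "orthonormal d k v \<longleftrightarrow> (\<forall>i<k. \<forall>j<k. ip d (v i) (v j) = (if i = j then 1 else 0))"

text \<open>For orthonormal \<open>v\<close>, this is the component of the \<open>j\<close>-th
  standard basis vector orthogonal to the first \<open>k\<close> vectors.\<close>

definition residual :: "nat \<Rightarrow> (nat \<Rightarrow> nat \<Rightarrow> real) \<Rightarrow> nat \<Rightarrow> nat \<Rightarrow> real" where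
  "residual k v j = (\<lambda>m. (if m = j then 1 else 0) - (\<Sum>i<k. v i j * v i m))"

lemma ip_residual:
  assumes "orthonormal d k v" "i < k" "j < d"
  shows "ip d (v i) (residual k v j) = 0"
proof -
  have "ip d (v i) (residual k v j) = v i j - (\<Sum>i'<k. v i' j * ip d (v i) (v i'))"
    using ip_diff_scaled[of d "v i" "\<lambda>m. if m = j then 1 else 0" 1 "\<lambda>m. \<Sum>i<k. v i j * v i m"] assms(3)
    by (simp add: residual_def ip_sum_right ip_scale ip_basis_vector)
  also have "(\<Sum>i'<k. v i' j * ip d (v i) (v i')) = (\<Sum>i'<k. if i = i' then v i' j else 0)"
    using assms(1,2) by (intro sum.cong refl) (simp add: orthonormal_def)
  finally show ?thesis using assms(2) by simp
qed

lemma ip_residual_self: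
  assumes "orthonormal d k v" "j < d"
  shows "ip d (residual k v j) (residual k v j) = 1 - (\<Sum>i<k. (v i j)\<^sup>2)"
proof -
  have "ip d (residual k v j) (residual k v j)
      = residual k v j j - (\<Sum>i<k. v i j * ip d (residual k v j) (v i))"
    using ip_diff_scaled[of d "residual k v j" "\<lambda>m. if m = j then 1 else 0" 1 "\<lambda>m. \<Sum>i<k. v i j * v i m"] assms(2)
    by (simp add: residual_def[of k v j, symmetric] ip_sum_right ip_scale ip_basis_vector)
  moreover have "ip d (residual k v j) (v i) = 0" if "i < k" for i
    using ip_residual[OF assms(1) that assms(2)] by (simp only: ip_commute)
  ultimately show ?thesis
    by simp (simp add: residual_def power2_eq_square)
qed

text \<open>A dimension count: the residuals cannot all vanish while \<open>k < d\<close>, which makes room for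
  another orthonormal vector, and they all vanish when \<open>k = d\<close>, which gives completeness.\<close>

lemma sum_ip_residual_self:
  assumes "orthonormal d k v"
  shows "(\<Sum>j<d. ip d (residual k v j) (residual k v j)) = real d - real k"
proof -
  have "(\<Sum>j<d. \<Sum>i<k. (v i j)\<^sup>2) = (\<Sum>i<k. ip d (v i) (v i))"
    unfolding ip_def power2_eq_square by (rule sum.swap)
  also have "\<dots> = real k" using assms by (simp add: orthonormal_def)
  finally show ?thesis
    by (simp add: ip_residual_self[OF assms] sum_subtractf)
qed

lemma orthonormal_basis_complete:
  assumes "orthonormal d d v" "j < d" "m < d"
  shows "(\<Sum>i<d. v i j * v i m) = (if m = j then 1 else 0)"
proof -
  have "ip d (residual d v j) (residual d v j) = 0"
    using sum_ip_residual_self[OF assms(1)] assms(2)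
    by (simp add: sum_nonneg_eq_0_iff ip_self_nonneg)
  from ip_self_eq_0[OF this assms(3)] show ?thesis
    by (simp add: residual_def)
qed

lemma ip_Parseval:
  assumes "orthonormal d d v"
  shows "ip d x y = (\<Sum>i<d. ip d x (v i) * ip d y (v i))"
proof -
  have "(\<Sum>i<d. ip d x (v i) * ip d y (v i)) = (\<Sum>i<d. \<Sum>j<d. \<Sum>m<d. x j * y m * (v i j * v i m))"
    by (simp add: ip_def sum_product mult_ac)
  also have "\<dots> = (\<Sum>j<d. \<Sum>i<d. \<Sum>m<d. x j * y m * (v i j * v i m))"
    by (rule sum.swap)
  also have "\<dots> = (\<Sum>j<d. \<Sum>m<d. \<Sum>i<d. x j * y m * (v i j * v i m))"
    by (intro sum.cong refl sum.swap)
  also have "\<dots> = (\<Sum>j<d. \<Sum>m<d. if m = j then x j * y m else 0)"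
    by (intro sum.cong refl) (simp add: orthonormal_basis_complete[OF assms] flip: sum_distrib_left)
  also have "\<dots> = ip d x y" by (simp add: ip_def)
  finally show ?thesis ..
qed

text \<open>Minimising the quadratic form over the unit sphere of the orthogonal complement
  of the eigenvectors found so far yields the next one.\<close>

lemma next_eigenvector:
  assumes sym: "\<And>i j. i < d \<Longrightarrow> j < d \<Longrightarrow> A i j = A j i"
    and on: "orthonormal d k v" and eig: "\<And>i j. i < k \<Longrightarrow> j < d \<Longrightarrow> mv d A (v i) j = l i * v i j"
    and "k < d"
  obtains x \<mu> where "ip d x x = 1" "\<And>i. i < k \<Longrightarrow> ip d x (v i) = 0" "\<And>j. j < d \<Longrightarrow> mv d A x j = \<mu> * x j"
proof -
  define W where "W = {x. \<forall>i<k. ip d x (v i) = 0}"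
  \<comment> \<open>Vectors are functions on all naturals, so the coordinates from \<open>d\<close>
    on are pinned to 0; the box is then compact in the product topology by Tychonoff.\<close>
  define box where "box = (PiE UNIV (\<lambda>j. if j < d then {-1..1} else {0}) :: (nat \<Rightarrow> real) set)"
  define K where "K = box \<inter> ({x. ip d x x = 1} \<inter> W)"
  define Q where "Q = (\<lambda>x. ip d x (mv d A x))"
  have "compactin (product_topology (\<lambda>_. euclidean) UNIV) box"
    unfolding box_def compactin_PiE by auto
  then have "compact box"
    by (metis compactin_euclidean_iff euclidean_product_topology)
  moreover have "closed ({x. ip d x x = 1} \<inter> W)"
    unfolding W_def
    by (intro closed_Int closed_Collect_all closed_Collect_imp open_Collect_const closed_Collect_eq
        continuous_on_ip continuous_on_coordinate continuous_on_const)
  ultimately have "compact K"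
    unfolding K_def by (rule compact_Int_closed)
  \<comment> \<open>Cutting off the coordinates from \<open>d\<close> on changes no value of
    \<open>ip d\<close>, and unit length bounds each remaining coordinate by 1.\<close>
  have normalize: "(\<lambda>j. if j < d then y j / sqrt (ip d y y) else 0) \<in> K" (is "?z \<in> K")
    if y: "y \<in> W" "ip d y y \<noteq> 0" for y
  proof -
    have pos: "0 < ip d y y" using ip_self_nonneg[of d y] y(2) by simp
    have z: "ip d ?z w = ip d y w / sqrt (ip d y y)" for w
      using ip_scale(1)[of d "1 / sqrt (ip d y y)" y w] by (simp add: ip_def)
    have one: "ip d ?z ?z = 1"
      using pos unfolding z by (subst ip_commute, subst z) (simp add: real_div_sqrt flip: real_sqrt_mult)
    have "- 1 \<le> y j / sqrt (ip d y y) \<and> y j / sqrt (ip d y y) \<le> 1" if "j < d" for j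
    proof -
      have "(?z j)\<^sup>2 \<le> ip d ?z ?z"
        unfolding ip_def power2_eq_square using that by (intro member_le_sum) auto
      then have "\<bar>?z j\<bar> \<le> 1" using one by (simp only: abs_square_le_1)
      then show ?thesis using that by (simp only: if_True) linarith
    qed
    then have "?z \<in> box" by (auto simp: box_def)
    then show ?thesis using one z y(1) by (simp add: K_def W_def)
  qed
  obtain j where j: "j < d" "ip d (residual k v j) (residual k v j) \<noteq> 0"
    using sum_ip_residual_self[OF on] \<open>k < d\<close> by (metis (no_types, lifting) diff_gt_0_iff_gt lessThan_iff less_irrefl of_nat_less_iff sum.neutral)
  have "residual k v j \<in> W"
    using ip_residual[OF on _ j(1)] by (simp add: W_def ip_commute)
  from normalize[OF this j(2)] have "K \<noteq> {}" by blast
  have "continuous_on K Q"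
    unfolding Q_def mv_eq_ip by (intro continuous_on_ip continuous_on_coordinate continuous_on_const)
  with continuous_attains_inf[OF \<open>compact K\<close> \<open>K \<noteq> {}\<close>]
  obtain x where x: "x \<in> K" "\<And>y. y \<in> K \<Longrightarrow> Q x \<le> Q y" by blast
  have x1: "ip d x x = 1" and xW: "x \<in> W" using x(1) by (auto simp: K_def)
  define \<mu> where "\<mu> = Q x"
  \<comment> \<open>Minimality on the sphere, made homogeneous so that it applies to unnormalized
    vectors.\<close>
  have Q_ge: "\<mu> * ip d y y \<le> Q y" if "y \<in> W" for y
  proof (cases "ip d y y = 0")
    case True
    have "Q y = 0" unfolding Q_def ip_def by (rule sum.neutral) (use ip_self_eq_0[OF True] in auto)
    then show ?thesis using True by simp
  next
    case False
    let ?z = "\<lambda>j. if j < d then y j / sqrt (ip d y y) else 0"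
    define c where "c = 1 / sqrt (ip d y y)"
    have c: "c * c = 1 / ip d y y"
      using ip_self_nonneg[of d y] by (simp add: c_def)
    have "Q ?z = Q (\<lambda>j. c * y j)"
      unfolding Q_def c_def by (rule ip_cong, simp, rule fun_cong[OF mv_cong], simp)
    also have "\<dots> = (c * c) * Q y"
      by (simp add: Q_def mv_scale ip_scale)
    also have "\<dots> = Q y / ip d y y"
      by (simp add: c)
    finally have "\<mu> \<le> Q y / ip d y y"
      using x(2)[OF normalize[OF that False]] by (simp add: \<mu>_def)
    then show ?thesis
      using False ip_self_nonneg[of d y] by (simp add: pos_le_divide_eq)
  qed
  \<comment> \<open>The defect in the eigenvalue equation. It stays in \<open>W\<close> because the
    complement of eigenvectors of a symmetric matrix is invariant.\<close>
  define r where "r = (\<lambda>j. mv d A x j - \<mu> * x j)"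
  have ip_r: "ip d y r = ip d y (mv d A x) - \<mu> * ip d y x" for y
    unfolding r_def by (rule ip_diff_scaled)
  have "ip d (v i) r = 0" if "i < k" for i
  proof -
    have "ip d (v i) (mv d A x) = ip d (mv d A (v i)) x"
      using ip_mv_symmetric[of d A "v i" x] sym by simp
    also have "\<dots> = ip d (\<lambda>j. l i * v i j) x"
      using eig[OF that] by (intro ip_cong) auto
    also have "\<dots> = 0" using xW that by (simp add: ip_scale W_def ip_commute[of d "v i"])
    finally show ?thesis using xW that by (simp add: ip_r W_def ip_commute[of d "v i"])
  qed
  then have rW: "r \<in> W" by (simp add: W_def ip_commute[of d r])
  have xr: "ip d x r = 0" by (simp add: ip_r x1 \<mu>_def Q_def)
  define R where "R = ip d r r"
  have rAx: "ip d r (mv d A x) = R"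
    using ip_r[of r] xr by (simp add: R_def ip_commute[of d r x])
  \<comment> \<open>Moving from the minimizer \<open>x\<close> to \<open>x - t r\<close> changes the
    form by \<open>- 2 * t * R\<close> to first order.\<close>
  have ineq: "2 * t * R \<le> t\<^sup>2 * (Q r - \<mu> * R)" for t
  proof -
    let ?y = "\<lambda>j. x j - t * r j"
    have "?y \<in> W"
      using xW rW by (simp add: W_def ip_commute[of d ?y] ip_diff_scaled) (simp add: ip_commute)
    from Q_ge[OF this] have "\<mu> * (1 + t\<^sup>2 * R) \<le> Q ?y"
      by (simp add: ip_diff_scaled_self x1 xr R_def)
    also have "Q ?y = Q x - 2 * t * R + t\<^sup>2 * Q r"
    proof -
      have "ip d x (mv d A r) = R"
        using rAx ip_mv_symmetric[of d A x r] sym by (simp add: ip_commute)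
      then show ?thesis
        using rAx unfolding Q_def mv_diff_scaled ip_diff_scaled
        by (simp add: ip_commute[of d ?y] ip_diff_scaled)
           (simp add: ip_commute[of d "mv d A _"] power2_eq_square algebra_simps)
    qed
    finally show ?thesis by (simp add: \<mu>_def algebra_simps)
  qed
  have "R = 0"
  proof (rule ccontr)
    assume "R \<noteq> 0"
    then have R: "0 < R" using ip_self_nonneg[of d r] by (simp add: R_def)
    \<comment> \<open>For small positive \<open>t\<close> the linear side of \<open>ineq\<close>
      would win if \<open>R > 0\<close>; \<open>t = R / c\<close> is small enough, and the summand 1
      keeps \<open>c\<close> positive.\<close>
    define c where "c = \<bar>Q r - \<mu> * R\<bar> + 1"
    have c: "0 < c" "Q r - \<mu> * R \<le> c" by (simp_all add: c_def)
    have "2 * (R / c) * R \<le> (R / c)\<^sup>2 * c"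
      using ineq[of "R / c"] mult_left_mono[OF c(2), of "(R / c)\<^sup>2"] by simp
    also have "\<dots> = (R / c) * R" using c(1) by (simp add: power2_eq_square)
    finally have "R / c * R \<le> 0" by simp
    then show False using R c(1) by (simp add: mult_le_0_iff divide_le_0_iff)
  qed
  then have "mv d A x j = \<mu> * x j" if "j < d" for j
    using ip_self_eq_0[of d r j] that by (simp add: R_def r_def)
  with x1 xW show ?thesis
    by (intro that[of x \<mu>]) (auto simp: W_def)
qed

lemma orthonormal_eigenvectors:
  assumes sym: "\<And>i j. i < d \<Longrightarrow> j < d \<Longrightarrow> A i j = A j i" and "k \<le> d"
  shows "\<exists>v l. orthonormal d k v \<and> (\<forall>i<k. \<forall>j<d. mv d A (v i) j = l i * v i j)"
  using \<open>k \<le> d\<close>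
proof (induction k)
  case 0
  then show ?case by (simp add: orthonormal_def)
next
  case (Suc k)
  then obtain v l where on: "orthonormal d k v" and eig: "\<forall>i<k. \<forall>j<d. mv d A (v i) j = l i * v i j"
    by auto
  obtain x \<mu> where "ip d x x = 1" "\<And>i. i < k \<Longrightarrow> ip d x (v i) = 0" "\<And>j. j < d \<Longrightarrow> mv d A x j = \<mu> * x j"
  proof (rule next_eigenvector[of d A k v l])
    show "k < d" using Suc.prems by simp
  qed (use sym on eig in auto)
  note x = this
  have vx: "ip d (v i) x = 0" if "i < k" for i
    using x(2)[OF that] by (simp only: ip_commute)
  have "orthonormal d (Suc k) (v(k := x))"
    unfolding orthonormal_def
  proof (intro allI impI)
    fix i j assume "i < Suc k" "j < Suc k"
    then consider "i < k" "j < k" | "i < k" "j = k" | "i = k" "j < k" | "i = k" "j = k"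
      by linarith
    then show "ip d ((v(k := x)) i) ((v(k := x)) j) = (if i = j then 1 else 0)"
      by cases (use on x(1,2) vx in \<open>auto simp: orthonormal_def\<close>)
  qed
  moreover have "\<forall>i<Suc k. \<forall>j<d. mv d A ((v(k := x)) i) j = (l(k := \<mu>)) i * (v(k := x)) i j"
    using eig x(3) by (simp add: less_Suc_eq)
  ultimately show ?case by blast
qed

text \<open>Parseval in each row of \<open>A\<close> turns the Frobenius norm into the sum of the
  squared lengths of the vectors \<open>mv d A (v i)\<close>.\<close>

lemma frob2_eq_sum_eigenvalues:
  assumes "orthonormal d d v" "\<And>i j. i < d \<Longrightarrow> j < d \<Longrightarrow> mv d A (v i) j = l i * v i j"
  shows "frob2 d A = (\<Sum>i<d. (l i)\<^sup>2)"
proof -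
  have "frob2 d A = (\<Sum>j<d. \<Sum>i<d. (mv d A (v i) j)\<^sup>2)"
    unfolding frob2_eq_sum_ip
    by (intro sum.cong refl) (simp add: ip_Parseval[OF assms(1), of "A j" "A j" for j] mv_eq_ip power2_eq_square)
  also have "\<dots> = (\<Sum>i<d. \<Sum>j<d. (l i)\<^sup>2 * (v i j * v i j))"
    by (subst sum.swap) (simp add: assms(2) power2_eq_square mult_ac)
  also have "\<dots> = (\<Sum>i<d. (l i)\<^sup>2 * ip d (v i) (v i))"
    by (simp add: ip_def sum_distrib_left)
  finally show ?thesis using assms(1) by (simp add: orthonormal_def)
qed

lemma ip_mv_eq_sum_eigenvalues:
  assumes "orthonormal d d v" "\<And>i j. i < d \<Longrightarrow> j < d \<Longrightarrow> mv d A (v i) j = l i * v i j"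
    and sym: "\<And>i j. i < d \<Longrightarrow> j < d \<Longrightarrow> A i j = A j i"
  shows "ip d x (mv d A x) = (\<Sum>i<d. l i * (ip d x (v i))\<^sup>2)"
proof -
  have "ip d (mv d A x) (v i) = l i * ip d x (v i)" if "i < d" for i
  proof -
    have "ip d (mv d A x) (v i) = ip d x (mv d A (v i))"
      by (rule ip_mv_symmetric[OF sym])
    also have "\<dots> = ip d x (\<lambda>j. l i * v i j)"
      by (intro ip_cong assms(2) that refl)
    finally show ?thesis by (simp add: ip_scale)
  qed
  then show ?thesis
    by (subst ip_Parseval[OF assms(1)]) (simp add: power2_eq_square mult_ac)
qed

section \<open>Transfer to matrices: characteristic polynomial, Schatten 2-norm and smallest
  eigenvalue\<close>

abbreviation entries :: "real mat \<Rightarrow> nat \<Rightarrow> nat \<Rightarrow> real" where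
  "entries A \<equiv> \<lambda>i j. A $$ (i, j)"

text \<open>The matrix \<open>P\<close> with columns \<open>v i\<close> is orthogonal and
  diagonalizes \<open>M\<close>. The product form records the multiplicities, which the Schatten
  norm needs.\<close>

lemma char_poly_eigenbasis:
  assumes M: "M \<in> carrier_mat d d" and on: "orthonormal d d v"
    and eig: "\<And>i j. i < d \<Longrightarrow> j < d \<Longrightarrow> mv d (entries M) (v i) j = l i * v i j"
  shows "char_poly M = (\<Prod>a\<leftarrow>map l [0..<d]. [:- a, 1:])"
proof -
  define P where "P = mat d d (\<lambda>(j, i). v i j)"
  define D where "D = mat d d (\<lambda>(i, j). if i = j then l i else 0)"
  have carrier: "P \<in> carrier_mat d d" "P\<^sup>T \<in> carrier_mat d d" "D \<in> carrier_mat d d"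
    by (simp_all add: P_def D_def)
  have PtP: "P\<^sup>T * P = 1\<^sub>m d"
    using on by (intro eq_matI) (auto simp: P_def scalar_prod_def orthonormal_def ip_def atLeast0LessThan)
  have PPt: "P * P\<^sup>T = 1\<^sub>m d"
    by (rule mat_mult_left_right_inverse[OF carrier(2,1) PtP])
  have "M * P = P * D"
  proof (rule eq_matI)
    fix j i assume "j < dim_row (P * D)" "i < dim_col (P * D)"
    then have ij: "j < d" "i < d" by (auto simp: P_def D_def)
    have "(M * P) $$ (j, i) = mv d (entries M) (v i) j"
      using M ij by (simp add: P_def scalar_prod_def mv_def atLeast0LessThan)
    moreover have "(P * D) $$ (j, i) = (\<Sum>m<d. if m = i then v i j * l i else 0)"
      using ij by (auto simp: P_def D_def scalar_prod_def atLeast0LessThan mult_delta_right)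
    ultimately show "(M * P) $$ (j, i) = (P * D) $$ (j, i)"
      using eig ij by simp
  qed (use M in \<open>auto simp: P_def D_def\<close>)
  then have "P * D * P\<^sup>T = M"
    using PPt M carrier by (metis assoc_mult_mat right_mult_one_mat)
  then have "similar_mat M D"
    using M carrier PPt PtP by (intro similar_matI[of _ _ P "P\<^sup>T" d]) auto
  then have "char_poly M = char_poly D" by (rule char_poly_similar)
  also have "\<dots> = (\<Prod>a\<leftarrow>diag_mat D. [:- a, 1:])"
    by (rule char_poly_upper_triangular[OF carrier(3)]) (auto simp: D_def upper_triangular_def)
  also have "diag_mat D = map l [0..<d]"
    by (auto simp: diag_mat_def D_def)
  finally show ?thesis .
qed

lemma proots_prod_linear: "proots (\<Prod>a\<leftarrow>xs. [:- a, 1:]) = mset (xs :: real list)"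
proof (induction xs)
  case (Cons a xs)
  have "(\<Prod>a\<leftarrow>xs. [:- a, 1:]) \<noteq> 0" by (auto simp: prod_list_zero_iff)
  then have "proots (\<Prod>a\<leftarrow>a # xs. [:- a, 1:]) = proots [:- a, 1:] + proots (\<Prod>a\<leftarrow>xs. [:- a, 1:])"
    unfolding list.map prod_list.Cons by (intro proots_mult) simp_all
  then show ?case
    unfolding Cons.IH proots_linear_factor by (metis add_mset_add_single minus_minus mset.simps(2) union_commute)
qed simp

context
  fixes A :: "real mat" and d :: nat
  assumes A: "A \<in> symmetric_mats d"
begin

lemma carrier_A: "A \<in> carrier_mat d d"
  using A by (simp add: symmetric_mats_def)

lemma entries_symmetric: "i < d \<Longrightarrow> j < d \<Longrightarrow> A $$ (i, j) = A $$ (j, i)"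
  using A carrier_A index_transpose_mat(1)[of j A i] by (simp add: symmetric_mats_def)

lemma eigenbasis:
  obtains v l where "orthonormal d d v" "\<And>i j. i < d \<Longrightarrow> j < d \<Longrightarrow> mv d (entries A) (v i) j = l i * v i j"
proof -
  have "\<exists>v l. orthonormal d d v \<and> (\<forall>i<d. \<forall>j<d. mv d (entries A) (v i) j = l i * v i j)"
    by (rule orthonormal_eigenvectors) (fact entries_symmetric order.refl)+
  with that show ?thesis by blast
qed

text \<open>An eigenbasis of \<open>A\<close> is one of \<open>A * A\<close> with squared
  eigenvalues, so the singular values are the numbers \<open>\<bar>l i\<bar>\<close> with
  multiplicity.\<close>

lemma schatten_norm_2_eq: "schatten_norm 2 A = sqrt (frob2 d (entries A))"
proof -
  obtain v l where on: "orthonormal d d v"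
    and eig: "\<And>i j. i < d \<Longrightarrow> j < d \<Longrightarrow> mv d (entries A) (v i) j = l i * v i j"
    using eigenbasis by blast
  have AT: "A\<^sup>T = A" using A by (simp add: symmetric_mats_def)
  have "mv d (entries (A * A)) (v i) j = (l i)\<^sup>2 * v i j" if ij: "i < d" "j < d" for i j
  proof -
    have "mv d (entries (A * A)) (v i) j = (\<Sum>m<d. \<Sum>n<d. A $$ (j, n) * A $$ (n, m) * v i m)"
      using carrier_A ij by (simp add: mv_def scalar_prod_def atLeast0LessThan sum_distrib_right)
    also have "\<dots> = (\<Sum>n<d. A $$ (j, n) * mv d (entries A) (v i) n)"
      by (subst sum.swap) (simp add: mv_def sum_distrib_left mult.assoc)
    also have "\<dots> = (\<Sum>n<d. A $$ (j, n) * (l i * v i n))"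
      using ij by (intro sum.cong refl) (simp add: eig)
    also have "\<dots> = l i * mv d (entries A) (v i) j"
      by (simp add: mv_def sum_distrib_left mult_ac)
    finally show ?thesis using ij by (simp add: eig power2_eq_square)
  qed
  then have "char_poly (A * A) = (\<Prod>a\<leftarrow>map (\<lambda>i. (l i)\<^sup>2) [0..<d]. [:- a, 1:])"
    using carrier_A on by (intro char_poly_eigenbasis) auto
  then have "singular_values A = image_mset (\<lambda>i. \<bar>l i\<bar>) (mset [0..<d])"
    unfolding singular_values_def AT by (simp only: proots_prod_linear) (simp add: image_mset.compositionality o_def)
  then have "(\<Sum>\<sigma>\<in>#singular_values A. \<sigma> powr 2) = (\<Sum>i<d. (l i)\<^sup>2)"
    by (simp add: image_mset.compositionality o_def sum_unfold_sum_mset atLeast0LessThan)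
  also have "\<dots> = frob2 d (entries A)"
    by (rule frob2_eq_sum_eigenvalues[OF on, symmetric]) (rule eig)
  finally show ?thesis
    by (simp add: schatten_norm_def powr_half_sqrt frob2_nonneg)
qed

text \<open>The spectrum is exactly the set of the \<open>l i\<close>, so its minimum belongs to
  some \<open>v i\<close>; the bound on the form is read off from its diagonal expression.\<close>

lemma lambda_min_eigenvector:
  assumes "0 < d"
  obtains v where "ip d v v = 1" "\<And>i. i < d \<Longrightarrow> mv d (entries A) v i = lambda_min A * v i"
    "\<And>y. lambda_min A * ip d y y \<le> ip d y (mv d (entries A) y)"
proof -
  obtain v l where on: "orthonormal d d v"
    and eig: "\<And>i j. i < d \<Longrightarrow> j < d \<Longrightarrow> mv d (entries A) (v i) j = l i * v i j"
    using eigenbasis by blast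
  have "char_poly A = (\<Prod>a\<leftarrow>map l [0..<d]. [:- a, 1:])"
    by (rule char_poly_eigenbasis[OF carrier_A on]) (rule eig)
  then have "spectrum A = l ` {..<d}"
    unfolding spectrum_root_char_poly[OF carrier_A]
    by (auto simp: poly_prod_list prod_list_zero_iff)
  then have min: "lambda_min A = Min (l ` {..<d})" by (simp add: lambda_min_def)
  have "lambda_min A \<in> l ` {..<d}"
    unfolding min using \<open>0 < d\<close> by (intro Min_in) auto
  then obtain i where i: "i < d" "lambda_min A = l i" by blast
  have "lambda_min A * ip d y y \<le> ip d y (mv d (entries A) y)" for y
  proof -
    have "lambda_min A * ip d y y = (\<Sum>i<d. lambda_min A * (ip d y (v i))\<^sup>2)"
      by (subst ip_Parseval[OF on]) (simp add: sum_distrib_left power2_eq_square)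
    also have "\<dots> \<le> (\<Sum>i<d. l i * (ip d y (v i))\<^sup>2)"
      by (intro sum_mono mult_right_mono) (auto simp: min)
    also have "\<dots> = ip d y (mv d (entries A) y)"
      by (rule ip_mv_eq_sum_eigenvalues[OF on, symmetric]) (fact eig entries_symmetric)+
    finally show ?thesis .
  qed
  with i eig on show ?thesis
    by (intro that[of "v i"]) (auto simp: orthonormal_def)
qed

end

section \<open>Expectations over sign vectors\<close>

abbreviation expect :: "'a pmf \<Rightarrow> ('a \<Rightarrow> real) \<Rightarrow> real" where
  "expect p f \<equiv> measure_pmf.expectation p f"

text \<open>Supports are kept finite throughout, which makes every function integrable.\<close>

lemma expect_bind:
  assumes "finite (set_pmf p)" "\<And>x. x \<in> set_pmf p \<Longrightarrow> finite (set_pmf (f x))"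
  shows "expect (bind_pmf p f) h = expect p (\<lambda>x. expect (f x) h)"
  using assms by (simp add: pmf_expectation_bind[of "set_pmf p"] integral_measure_pmf[of "set_pmf p"])

lemma expect_mono:
  assumes "finite (set_pmf p)" "\<And>x. x \<in> set_pmf p \<Longrightarrow> f x \<le> g x"
  shows "expect p f \<le> expect p g"
  using assms by (intro integral_mono_AE integrable_measure_pmf_finite) (auto simp: AE_measure_pmf_iff)

lemma expect_add:
  "finite (set_pmf p) \<Longrightarrow> expect p (\<lambda>x. f x + g x) = expect p f + expect p g"
  by (intro Bochner_Integration.integral_add integrable_measure_pmf_finite)

lemma expect_diff:
  "finite (set_pmf p) \<Longrightarrow> expect p (\<lambda>x. f x - g x) = expect p f - expect p g"
  by (intro Bochner_Integration.integral_diff integrable_measure_pmf_finite)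

lemma expect_sum:
  "finite (set_pmf p) \<Longrightarrow> expect p (\<lambda>x. \<Sum>i\<in>I. f i x) = (\<Sum>i\<in>I. expect p (f i))"
  by (intro Bochner_Integration.integral_sum integrable_measure_pmf_finite)

lemma expect_nonneg: "(\<And>x. 0 \<le> f x) \<Longrightarrow> 0 \<le> expect p f"
  by (rule Bochner_Integration.integral_nonneg) simp

lemma prob_bind:
  assumes "finite (set_pmf p)" "\<And>x. x \<in> set_pmf p \<Longrightarrow> finite (set_pmf (f x))"
  shows "measure_pmf.prob (bind_pmf p f) S = expect p (\<lambda>x. measure_pmf.prob (f x) S)"
  using expect_bind[OF assms, where h = "indicator S"] by simp

text \<open>A union bound in two stages: the first draw is bad, or it is good and the second stage
  fails.\<close>

lemma prob_bind_le:
  assumes fin: "finite (set_pmf p)" "\<And>x. x \<in> set_pmf p \<Longrightarrow> finite (set_pmf (f x))"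
    and bad: "measure_pmf.prob p {x. \<not> G x} \<le> a"
    and step: "\<And>x. x \<in> set_pmf p \<Longrightarrow> G x \<Longrightarrow> measure_pmf.prob (f x) S \<le> b"
    and "0 \<le> b"
  shows "measure_pmf.prob (bind_pmf p f) S \<le> a + b"
proof -
  have *: "measure_pmf.prob (f x) S \<le> indicator {x. \<not> G x} x + b" if "x \<in> set_pmf p" for x
    using step[OF that] \<open>0 \<le> b\<close> measure_pmf.prob_le_1[of "f x" S]
    by (cases "G x") (auto intro: order_trans)
  have "measure_pmf.prob (bind_pmf p f) S = expect p (\<lambda>x. measure_pmf.prob (f x) S)"
    by (rule prob_bind[OF fin])
  also have "\<dots> \<le> expect p (\<lambda>x. indicator {x. \<not> G x} x + b)"
    by (intro expect_mono fin(1) *)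
  also have "\<dots> = measure_pmf.prob p {x. \<not> G x} + b"
    by (simp add: expect_add fin)
  finally show ?thesis using bad by simp
qed

text \<open>The event is strict so that \<open>c = 0\<close> is covered: then \<open>f\<close>
  vanishes on the support. This case occurs for the zero matrix.\<close>

lemma prob_Markov:
  assumes "finite (set_pmf p)" "\<And>x. 0 \<le> f x" "expect p f \<le> a * c" "0 \<le> c" "0 \<le> a"
  shows "measure_pmf.prob p {x. c < f x} \<le> a"
proof (cases "c = 0")
  case True
  then have "expect p f = 0"
    using assms(3) expect_nonneg[of f p, OF assms(2)] by simp
  then have "AE x in measure_pmf p. f x = 0"
    using assms(1,2) by (subst (asm) integral_nonneg_eq_0_iff_AE) (auto intro: integrable_measure_pmf_finite)
  then have "set_pmf p \<inter> {x. c < f x} = {}"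
    using True by (auto simp: AE_measure_pmf_iff)
  then have "measure_pmf.prob p {x. c < f x} = 0"
    by (simp only: measure_pmf_zero_iff)
  then show ?thesis using assms(5) by simp
next
  case False
  have "c * measure_pmf.prob p {x. c < f x} = expect p (\<lambda>x. c * indicator {x. c < f x} x)"
    by simp
  also have "\<dots> \<le> expect p f"
    using assms(2,4) by (intro expect_mono assms(1)) (auto simp: indicator_def)
  finally have "c * measure_pmf.prob p {x. c < f x} \<le> c * a"
    using assms(3) by (simp add: mult.commute)
  then show ?thesis
    using assms(4) False by simp
qed

lemma finite_set_replicate_pmf [simp]:
  "finite (set_pmf p) \<Longrightarrow> finite (set_pmf (replicate_pmf n p))"
  by (induction n) auto

lemma expect_replicate_Suc:
  assumes "finite (set_pmf p)"
  shows "expect (replicate_pmf (Suc n) p) h = expect p (\<lambda>x. expect (replicate_pmf n p) (\<lambda>xs. h (x # xs)))"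
  using assms by (simp add: expect_bind)

lemma expect_pair:
  assumes "finite (set_pmf p)" "finite (set_pmf q)"
  shows "expect (pair_pmf p q) h = expect p (\<lambda>x. expect q (\<lambda>y. h (x, y)))"
  using assms by (simp add: pair_pmf_def expect_bind)

section \<open>Second and fourth moments of random sign vectors\<close>

primrec signs :: "nat \<Rightarrow> (nat \<Rightarrow> real) pmf" where
  "signs 0 = return_pmf (\<lambda>_. 0)"
| "signs (Suc d) = bind_pmf (signs d) (\<lambda>g. map_pmf (\<lambda>s. g(d := s)) (pmf_of_set {-1, 1}))"

lemma finite_set_signs [simp]: "finite (set_pmf (signs d))"
  by (induction d) auto

lemma expect_signs_Suc:
  "expect (signs (Suc d)) h = expect (signs d) (\<lambda>g. (h (g(d := -1)) + h (g(d := 1))) / 2)"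
  by (simp add: expect_bind integral_pmf_of_set)

lemma ip_fun_upd: "ip (Suc d) (g(d := s)) a = ip d g a + s * a d"
  by (simp add: ip_def)

lemma ip_Suc: "ip (Suc d) a b = ip d a b + a d * b d"
  by (simp add: ip_def)

text \<open>The covariance of a random sign vector is the identity; averaging over the last sign
  cancels the mixed terms.\<close>

lemma expect_signs_ip_ip: "expect (signs d) (\<lambda>g. ip d g a * ip d g b) = ip d a b"
proof (induction d)
  case 0
  then show ?case by (simp add: ip_def)
next
  case (Suc d)
  have "expect (signs (Suc d)) (\<lambda>g. ip (Suc d) g a * ip (Suc d) g b)
      = expect (signs d) (\<lambda>g. ip d g a * ip d g b + a d * b d)"
    unfolding expect_signs_Suc ip_fun_upd
    by (intro Bochner_Integration.integral_cong refl) (simp add: field_simps)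
  then show ?case
    by (simp add: expect_add Suc.IH ip_Suc)
qed

lemma expect_signs_ip_sq: "expect (signs d) (\<lambda>g. (ip d g a)\<^sup>2) = ip d a a"
  using expect_signs_ip_ip[of d a a] by (simp add: power2_eq_square)

text \<open>Adding a coordinate produces the mixed term \<open>4 * ?x * ?y * ip d a b\<close>, and
  the constant 3 leaves just enough room for it.\<close>

lemma expect_signs_ip_sq_ip_sq:
  "expect (signs d) (\<lambda>g. (ip d g a)\<^sup>2 * (ip d g b)\<^sup>2) \<le> 3 * ip d a a * ip d b b"
proof (induction d)
  case 0
  then show ?case by (simp add: ip_def)
next
  case (Suc d)
  let ?x = "a d" and ?y = "b d"
  have "expect (signs (Suc d)) (\<lambda>g. (ip (Suc d) g a)\<^sup>2 * (ip (Suc d) g b)\<^sup>2)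
      = expect (signs d) (\<lambda>g. (ip d g a)\<^sup>2 * (ip d g b)\<^sup>2 + ?x\<^sup>2 * (ip d g b)\<^sup>2 + ?y\<^sup>2 * (ip d g a)\<^sup>2
          + (4 * ?x * ?y) * (ip d g a * ip d g b) + ?x\<^sup>2 * ?y\<^sup>2)"
    unfolding expect_signs_Suc ip_fun_upd
    by (intro Bochner_Integration.integral_cong refl) (simp add: field_simps power2_eq_square)
  also have "\<dots> = expect (signs d) (\<lambda>g. (ip d g a)\<^sup>2 * (ip d g b)\<^sup>2) + ?x\<^sup>2 * ip d b b
      + ?y\<^sup>2 * ip d a a + 4 * ?x * ?y * ip d a b + ?x\<^sup>2 * ?y\<^sup>2"
    by (simp add: expect_add expect_signs_ip_ip expect_signs_ip_sq)
  also have "\<dots> \<le> 3 * ip d a a * ip d b b + ?x\<^sup>2 * ip d b b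
      + ?y\<^sup>2 * ip d a a + 4 * ?x * ?y * ip d a b + ?x\<^sup>2 * ?y\<^sup>2"
    using Suc.IH by simp
  also have "\<dots> \<le> 3 * (ip d a a + ?x * ?x) * (ip d b b + ?y * ?y)"
  proof -
    \<comment> \<open>Nonnegativity of this squared length bounds the mixed term by twice the two
      terms with \<open>?x\<^sup>2\<close> and \<open>?y\<^sup>2\<close>.\<close>
    have "0 \<le> ip d (\<lambda>i. ?x * b i - ?y * a i) (\<lambda>i. ?x * b i - ?y * a i)"
      by (rule ip_self_nonneg)
    also have "\<dots> = ?x\<^sup>2 * ip d b b - 2 * ?x * ?y * ip d a b + ?y\<^sup>2 * ip d a a"
      by (simp add: ip_def algebra_simps power2_eq_square sum.distrib sum_subtractf sum_distrib_left)
    finally have "2 * ?x * ?y * ip d a b \<le> ?x\<^sup>2 * ip d b b + ?y\<^sup>2 * ip d a a"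
      by simp
    moreover have "0 \<le> ?x\<^sup>2 * ?y\<^sup>2" by simp
    ultimately show ?thesis
      by (simp add: algebra_simps power2_eq_square)
  qed
  finally show ?case by (simp add: ip_Suc)
qed

lemma expect_signs_ip_sq_mv:
  "expect (signs d) (\<lambda>g. (ip d g w)\<^sup>2 * ip d (mv d A g) (mv d A g)) \<le> 3 * ip d w w * frob2 d A"
proof -
  have "expect (signs d) (\<lambda>g. (ip d g w)\<^sup>2 * ip d (mv d A g) (mv d A g))
      = (\<Sum>i<d. expect (signs d) (\<lambda>g. (ip d g w)\<^sup>2 * (ip d g (A i))\<^sup>2))"
    by (simp add: ip_def[of _ "mv d A _"] mv_eq_ip sum_distrib_left flip: expect_sum)
       (simp add: ip_commute power2_eq_square)
  also have "\<dots> \<le> (\<Sum>i<d. 3 * ip d w w * ip d (A i) (A i))"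
    by (intro sum_mono expect_signs_ip_sq_ip_sq)
  finally show ?thesis
    by (simp add: frob2_eq_sum_ip sum_distrib_left)
qed

lemma expect_signs_mv_sq: "expect (signs d) (\<lambda>g. ip d (mv d B g) (mv d B g)) = frob2 d B"
proof -
  have "expect (signs d) (\<lambda>g. ip d (mv d B g) (mv d B g)) = (\<Sum>i<d. expect (signs d) (\<lambda>g. (ip d g (B i))\<^sup>2))"
    by (simp add: ip_def[of _ "mv d B _"] mv_eq_ip flip: expect_sum)
       (simp add: ip_commute power2_eq_square)
  then show ?thesis
    by (simp add: expect_signs_ip_sq frob2_eq_sum_ip)
qed

text \<open>One of the two factors is expanded into rows, and \<open>expect_signs_ip_sq_mv\<close>
  handles each row times the other factor.\<close>

lemma expect_signs_mv_4:
  "expect (signs d) (\<lambda>g. (ip d (mv d B g) (mv d B g))\<^sup>2) \<le> 3 * (frob2 d B)\<^sup>2"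
proof -
  have "expect (signs d) (\<lambda>g. (ip d (mv d B g) (mv d B g))\<^sup>2)
     = (\<Sum>i<d. expect (signs d) (\<lambda>g. (ip d g (B i))\<^sup>2 * ip d (mv d B g) (mv d B g)))"
    by (simp add: power2_eq_square[of "ip d (mv d B _) _"] flip: expect_sum)
       (simp add: ip_def[of _ "mv d B _"] mv_eq_ip ip_commute power2_eq_square sum_distrib_right)
  also have "\<dots> \<le> (\<Sum>i<d. 3 * ip d (B i) (B i) * frob2 d B)"
    by (intro sum_mono expect_signs_ip_sq_mv)
  finally show ?thesis
    by (simp add: power2_eq_square frob2_eq_sum_ip flip: sum_distrib_left sum_distrib_right mult.assoc)
qed

section \<open>Estimating the Frobenius norm from random bilinear forms\<close>

definition sketch :: "nat \<Rightarrow> (nat \<Rightarrow> nat \<Rightarrow> real) \<Rightarrow> (nat \<Rightarrow> real) \<times> (nat \<Rightarrow> real) \<Rightarrow> real" where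
  "sketch d B = (\<lambda>(h, g). (ip d h (mv d B g))\<^sup>2)"

definition sign_pairs :: "nat \<Rightarrow> ((nat \<Rightarrow> real) \<times> (nat \<Rightarrow> real)) pmf" where
  "sign_pairs d = pair_pmf (signs d) (signs d)"

lemma finite_set_sign_pairs [simp]: "finite (set_pmf (sign_pairs d))"
  by (simp add: sign_pairs_def)

lemma expect_swap:
  assumes "finite (set_pmf p)" "finite (set_pmf q)"
  shows "expect p (\<lambda>x. expect q (f x)) = expect q (\<lambda>y. expect p (\<lambda>x. f x y))"
  using assms
  by (simp add: integral_measure_pmf[of "set_pmf p"] integral_measure_pmf[of "set_pmf q"]
      sum_distrib_left mult.left_commute sum.swap[of _ "set_pmf p"])

text \<open>For fixed \<open>g\<close>, averaging over \<open>h\<close> gives the squared length of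
  \<open>mv d B g\<close>; averaging over \<open>g\<close> then gives
  \<open>frob2 d B\<close>.\<close>

lemma expect_sketch: "expect (sign_pairs d) (sketch d B) = frob2 d B"
proof -
  have "expect (sign_pairs d) (sketch d B)
      = expect (signs d) (\<lambda>g. expect (signs d) (\<lambda>h. (ip d h (mv d B g))\<^sup>2))"
    unfolding sign_pairs_def sketch_def
    by (simp add: expect_pair, rule expect_swap) simp_all
  then show ?thesis
    by (simp add: expect_signs_ip_sq expect_signs_mv_sq)
qed

text \<open>Each of the two averagings costs one factor 3.\<close>

lemma expect_sketch_sq: "expect (sign_pairs d) (\<lambda>z. (sketch d B z)\<^sup>2) \<le> 9 * (frob2 d B)\<^sup>2"
proof -
  have "expect (sign_pairs d) (\<lambda>z. (sketch d B z)\<^sup>2)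
      = expect (signs d) (\<lambda>g. expect (signs d) (\<lambda>h. (ip d h (mv d B g))\<^sup>2 * (ip d h (mv d B g))\<^sup>2))"
    unfolding sign_pairs_def sketch_def
    by (simp add: expect_pair power2_eq_square, rule expect_swap) simp_all
  also have "\<dots> \<le> expect (signs d) (\<lambda>g. 3 * (ip d (mv d B g) (mv d B g))\<^sup>2)"
    by (intro expect_mono finite_set_signs order.trans[OF expect_signs_ip_sq_ip_sq])
       (simp add: power2_eq_square)
  also have "\<dots> \<le> 9 * (frob2 d B)\<^sup>2"
    using expect_signs_mv_4[of d B] by simp
  finally show ?thesis .
qed

lemma expect_sum_list_deviation:
  assumes fin: "finite (set_pmf p)" and mean: "expect p X = \<mu>" and var: "expect p (\<lambda>x. (X x)\<^sup>2) \<le> \<mu>\<^sup>2 + v"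
  shows "expect (replicate_pmf n p) (\<lambda>xs. sum_list (map X xs) - n * \<mu>) = 0"
    and "expect (replicate_pmf n p) (\<lambda>xs. (sum_list (map X xs) - n * \<mu>)\<^sup>2) \<le> n * v"
proof -
  show zero: "expect (replicate_pmf n p) (\<lambda>xs. sum_list (map X xs) - n * \<mu>) = 0" for n
  proof (induction n)
    case (Suc n)
    have "expect (replicate_pmf n p) (\<lambda>xs. sum_list (map X xs)) = n * \<mu>"
      using Suc.IH by (simp add: expect_diff fin)
    then show ?case
      unfolding expect_replicate_Suc[OF fin]
      by (simp add: expect_add expect_diff fin mean algebra_simps)
  qed simp
  show "expect (replicate_pmf n p) (\<lambda>xs. (sum_list (map X xs) - n * \<mu>)\<^sup>2) \<le> n * v"
  proof (induction n)
    case (Suc n)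
    \<comment> \<open>The first sample is split off; the mixed term vanishes by \<open>zero\<close>,
      so variances add.\<close>
    have "expect (replicate_pmf (Suc n) p) (\<lambda>xs. (sum_list (map X xs) - Suc n * \<mu>)\<^sup>2)
        = expect p (\<lambda>x. expect (replicate_pmf n p) (\<lambda>xs. (X x - \<mu>)\<^sup>2
            + 2 * (X x - \<mu>) * (sum_list (map X xs) - n * \<mu>) + (sum_list (map X xs) - n * \<mu>)\<^sup>2))"
      unfolding expect_replicate_Suc[OF fin]
      by (intro Bochner_Integration.integral_cong refl) (simp add: algebra_simps power2_eq_square)
    also have "\<dots> = expect p (\<lambda>x. (X x)\<^sup>2 - 2 * \<mu> * X x + \<mu>\<^sup>2
        + expect (replicate_pmf n p) (\<lambda>xs. (sum_list (map X xs) - n * \<mu>)\<^sup>2))"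
      by (simp add: expect_add fin zero) (simp add: power2_diff algebra_simps fin expect_add expect_diff)
    also have "\<dots> \<le> v + n * v"
      using Suc.IH var mean by (simp add: expect_add expect_diff fin power2_eq_square)
    finally show ?case by (simp add: algebra_simps)
  qed simp
qed

definition avg :: "('a \<Rightarrow> real) \<Rightarrow> 'a list \<Rightarrow> real" where
  "avg X xs = sum_list (map X xs) / length xs"

text \<open>Chebyshev: one sample has variance at most \<open>(9 - 1) * \<mu>\<^sup>2\<close>, and
  allowing a deviation of half the mean costs a factor 4.\<close>

lemma prob_avg_sketch:
  assumes "0 < n"
  shows "measure_pmf.prob (replicate_pmf n (sign_pairs d))
           {zs. \<not> \<bar>avg (sketch d B) zs - frob2 d B\<bar> \<le> frob2 d B / 2} \<le> 32 / n"
proof -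
  define \<mu> where "\<mu> = frob2 d B"
  have pos: "0 \<le> \<mu>" by (simp add: \<mu>_def frob2_nonneg)
  let ?D = "\<lambda>zs. sum_list (map (sketch d B) zs) - real n * \<mu>"
  have "measure_pmf.prob (replicate_pmf n (sign_pairs d)) {zs. (real n * \<mu> / 2)\<^sup>2 < (?D zs)\<^sup>2} \<le> 32 / n"
  proof (rule prob_Markov)
    have "expect (replicate_pmf n (sign_pairs d)) (\<lambda>zs. (?D zs)\<^sup>2) \<le> n * (8 * \<mu>\<^sup>2)"
      using expect_sketch_sq[of d B]
      by (intro expect_sum_list_deviation(2)) (simp_all add: expect_sketch \<mu>_def)
    also have "\<dots> = 32 / n * (real n * \<mu> / 2)\<^sup>2"
      using assms by (simp add: power2_eq_square)
    finally show "expect (replicate_pmf n (sign_pairs d)) (\<lambda>zs. (?D zs)\<^sup>2) \<le> 32 / n * (real n * \<mu> / 2)\<^sup>2" .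
  qed (use assms pos in auto)
  moreover have "measure_pmf.prob (replicate_pmf n (sign_pairs d))
           {zs. \<not> \<bar>avg (sketch d B) zs - frob2 d B\<bar> \<le> frob2 d B / 2}
      \<le> measure_pmf.prob (replicate_pmf n (sign_pairs d)) {zs. (real n * \<mu> / 2)\<^sup>2 < (?D zs)\<^sup>2}"
  proof (rule measure_pmf.finite_measure_mono_AE)
    have "(real n * \<mu> / 2)\<^sup>2 < (?D zs)\<^sup>2"
      if n: "length zs = n" and dev: "\<not> \<bar>avg (sketch d B) zs - \<mu>\<bar> \<le> \<mu> / 2" for zs
    proof -
      have "real n * (\<mu> / 2) < n * \<bar>avg (sketch d B) zs - \<mu>\<bar>"
        using assms dev by simp
      also have "\<dots> = \<bar>n * (avg (sketch d B) zs - \<mu>)\<bar>"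
        by (simp add: abs_mult)
      also have "n * (avg (sketch d B) zs - \<mu>) = ?D zs"
        using assms n by (simp add: avg_def algebra_simps)
      finally have "\<bar>real n * \<mu> / 2\<bar> < \<bar>?D zs\<bar>"
        using pos by simp
      then show ?thesis
        by (metis power2_abs power_strict_mono abs_ge_zero zero_less_numeral)
    qed
    then show "AE zs in measure_pmf (replicate_pmf n (sign_pairs d)). zs \<in> {zs. \<not> \<bar>avg (sketch d B) zs - frob2 d B\<bar> \<le> frob2 d B / 2}
        \<longrightarrow> zs \<in> {zs. (real n * \<mu> / 2)\<^sup>2 < (?D zs)\<^sup>2}"
      by (simp add: AE_measure_pmf_iff set_replicate_pmf \<mu>_def)
  qed simp
  ultimately show ?thesis by simp
qed

section \<open>The random walk\<close>

text \<open>The matrix enters a step only through the scalar \<open>ip d g (mv d A x)\<close>, which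
  is the answer to one query with \<open>g\<close> and the current \<open>x\<close>.\<close>

primrec run :: "nat \<Rightarrow> (nat \<Rightarrow> nat \<Rightarrow> real) \<Rightarrow> real \<Rightarrow> (nat \<Rightarrow> real) list \<Rightarrow> (nat \<Rightarrow> real) \<Rightarrow> nat \<Rightarrow> real" where
  "run d A \<eta> [] x = x"
| "run d A \<eta> (g # gs) x = run d A \<eta> gs (\<lambda>i. x i - \<eta> * ip d g (mv d A x) * g i)"

text \<open>The matrix \<open>A P\<close>, where \<open>P\<close> is the linear map \<open>run d A \<eta> gs\<close>.\<close>

primrec walk_mat :: "nat \<Rightarrow> (nat \<Rightarrow> nat \<Rightarrow> real) \<Rightarrow> real \<Rightarrow> (nat \<Rightarrow> real) list \<Rightarrow> nat \<Rightarrow> nat \<Rightarrow> real" where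
  "walk_mat d A \<eta> [] = A"
| "walk_mat d A \<eta> (g # gs) = (\<lambda>i j. walk_mat d A \<eta> gs i j
      - \<eta> * (\<Sum>k<d. g k * A k j) * mv d (walk_mat d A \<eta> gs) g i)"

text \<open>Links the adaptive walk to a matrix that is fixed once \<open>gs\<close> is drawn, so
  that the sketch bounds apply to it.\<close>

lemma mv_walk_mat: "mv d (walk_mat d A \<eta> gs) x = mv d A (run d A \<eta> gs x)"
proof (induction gs arbitrary: x)
  case (Cons g gs)
  let ?B = "walk_mat d A \<eta> gs"
  have "ip d g (mv d A x) = (\<Sum>j<d. (\<Sum>k<d. g k * A k j) * x j)"
    unfolding ip_def mv_def sum_distrib_left sum_distrib_right
    by (subst sum.swap) (simp add: mult.assoc)
  then have "\<eta> * ip d g (mv d A x) * mv d ?B g i = (\<Sum>j<d. \<eta> * (\<Sum>k<d. g k * A k j) * mv d ?B g i * x j)" for i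
    by (simp add: sum_distrib_left sum_distrib_right mult_ac)
  moreover have "mv d (walk_mat d A \<eta> (g # gs)) x i
      = mv d ?B x i - (\<Sum>j<d. \<eta> * (\<Sum>k<d. g k * A k j) * mv d ?B g i * x j)" for i
    by (simp add: mv_def[of d _ x] left_diff_distrib sum_subtractf)
  ultimately show ?case
    by (auto simp: mv_diff_scaled simp flip: Cons.IH)
qed simp

text \<open>Reduces the norm of the walk matrix to walks started at the standard basis
  vectors.\<close>

lemma frob2_eq_sum_columns:
  "frob2 d B = (\<Sum>k<d. ip d (mv d B (\<lambda>i. if i = k then 1 else 0)) (mv d B (\<lambda>i. if i = k then 1 else 0)))"
proof -
  have "mv d B (\<lambda>i. if i = k then 1 else 0) i = B i k" if "k < d" for i k
    using that by (simp add: mv_eq_ip ip_basis_vector)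
  then show ?thesis
    by (simp add: frob2_def ip_def power2_eq_square) (rule sum.swap)
qed

section \<open>Drift and second moments of the walk\<close>

text \<open>Positive semidefinite inputs are the case \<open>l = 0\<close>; for far inputs
  \<open>l\<close> is minus the smallest eigenvalue.\<close>

locale query_walk =
  fixes d :: nat and A :: "nat \<Rightarrow> nat \<Rightarrow> real" and \<eta> l :: real
  assumes symmetric: "\<And>i j. i < d \<Longrightarrow> j < d \<Longrightarrow> A i j = A j i"
    and step_nonneg: "0 \<le> \<eta>"
    and lower: "\<And>y. - l * ip d y y \<le> ip d y (mv d A y)"
    and lambda_nonneg: "0 \<le> l"
begin

abbreviation move :: "(nat \<Rightarrow> real) \<Rightarrow> (nat \<Rightarrow> real) \<Rightarrow> nat \<Rightarrow> real" where
  "move x g \<equiv> \<lambda>i. x i - \<eta> * ip d g (mv d A x) * g i"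

abbreviation energy :: "(nat \<Rightarrow> real) \<Rightarrow> real" where
  "energy x \<equiv> ip d (mv d A x) (mv d A x)"

text \<open>The bound on the growth of the expected energy per step: \<open>2 * \<eta> * l\<close>
  comes from the drift, the last summand from the fourth moment.\<close>

definition \<rho> :: real where
  "\<rho> = 1 + 2 * \<eta> * l + 3 * \<eta>\<^sup>2 * frob2 d A"

lemma rho_nonneg: "0 \<le> \<rho>"
  using step_nonneg lambda_nonneg frob2_nonneg[of d A] by (simp add: \<rho>_def)

lemma expect_energy_move: "expect (signs d) (\<lambda>g. energy (move x g)) \<le> \<rho> * energy x"
proof -
  let ?w = "mv d A x"
  have expand: "energy (move x g) = energy x - 2 * \<eta> * (ip d g ?w * ip d g (mv d A ?w))
      + \<eta>\<^sup>2 * ((ip d g ?w)\<^sup>2 * energy g)" for g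
  proof -
    have "ip d ?w (mv d A g) = ip d g (mv d A ?w)"
      using ip_mv_symmetric[of d A ?w g] symmetric by (simp add: ip_commute)
    then show ?thesis
      unfolding mv_diff_scaled ip_diff_scaled_self by (simp add: power_mult_distrib)
  qed
  have "expect (signs d) (\<lambda>g. energy (move x g)) = energy x - 2 * \<eta> * ip d ?w (mv d A ?w)
      + \<eta>\<^sup>2 * expect (signs d) (\<lambda>g. (ip d g ?w)\<^sup>2 * energy g)"
    unfolding expand by (simp add: expect_add expect_diff expect_signs_ip_ip)
  also have "\<dots> \<le> energy x - 2 * \<eta> * (- l * energy x) + \<eta>\<^sup>2 * (3 * energy x * frob2 d A)"
    using step_nonneg
    by (intro add_mono diff_mono mult_left_mono lower expect_signs_ip_sq_mv order.refl) auto
  finally show ?thesis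
    by (simp add: \<rho>_def algebra_simps)
qed

lemma expect_energy_run:
  "expect (replicate_pmf n (signs d)) (\<lambda>gs. energy (run d A \<eta> gs x)) \<le> \<rho> ^ n * energy x"
proof (induction n arbitrary: x)
  case (Suc n)
  have "expect (replicate_pmf (Suc n) (signs d)) (\<lambda>gs. energy (run d A \<eta> gs x))
      \<le> expect (signs d) (\<lambda>g. \<rho> ^ n * energy (move x g))"
    unfolding expect_replicate_Suc[OF finite_set_signs] run.simps
    by (intro expect_mono finite_set_signs Suc.IH)
  also have "\<dots> \<le> \<rho> ^ n * (\<rho> * energy x)"
    using expect_energy_move rho_nonneg by (simp add: mult_left_mono)
  finally show ?case by (simp add: mult_ac)
qed simp

context
  fixes v :: "nat \<Rightarrow> real"
  assumes unit: "ip d v v = 1"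
    and eigen: "\<And>i. i < d \<Longrightarrow> mv d A v i = - l * v i"
begin

lemma ip_eigen: "ip d v (mv d A x) = - l * ip d v x"
  using eigen by (simp flip: ip_mv_symmetric[OF symmetric]) (simp add: ip_def sum_distrib_left sum_negf mult.assoc)

lemma energy_eigen: "energy v = l\<^sup>2"
proof -
  have "energy v = (\<Sum>i<d. l\<^sup>2 * (v i * v i))"
    unfolding ip_def by (intro sum.cong refl) (simp add: eigen power2_eq_square)
  then show ?thesis using unit by (simp add: ip_def flip: sum_distrib_left)
qed

lemma ip_move: "ip d v (move x g) = ip d v x - \<eta> * (ip d g (mv d A x) * ip d g v)"
  using ip_commute[of d g v] by (simp add: ip_diff_scaled)

lemma expect_ip_move: "expect (signs d) (\<lambda>g. ip d v (move x g)) = (1 + \<eta> * l) * ip d v x"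
proof -
  have "expect (signs d) (\<lambda>g. ip d v (move x g)) = ip d v x - \<eta> * ip d v (mv d A x)"
    by (simp add: ip_move expect_diff expect_signs_ip_ip ip_commute[of d "mv d A x"])
  then show ?thesis by (simp add: ip_eigen algebra_simps)
qed

text \<open>The left side is a variance, hence at most the second moment, which the fourth moment
  bound controls as \<open>v\<close> is a unit vector.\<close>

lemma expect_ip_move_deviation:
  "expect (signs d) (\<lambda>g. (ip d v (move x g) - (1 + \<eta> * l) * ip d v x)\<^sup>2) \<le> 3 * \<eta>\<^sup>2 * energy x"
proof -
  let ?Z = "\<lambda>g. ip d g (mv d A x) * ip d g v"
  have "expect (signs d) (\<lambda>g. (ip d v (move x g) - (1 + \<eta> * l) * ip d v x)\<^sup>2)
      = expect (signs d) (\<lambda>g. \<eta>\<^sup>2 * ((ip d g (mv d A x))\<^sup>2 * (ip d g v)\<^sup>2 - 2 * (- l * ip d v x) * ?Z g + (l * ip d v x)\<^sup>2))"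
    unfolding ip_move
    by (intro Bochner_Integration.integral_cong refl) (simp add: power2_eq_square algebra_simps)
  also have "\<dots> = \<eta>\<^sup>2 * (expect (signs d) (\<lambda>g. (ip d g (mv d A x))\<^sup>2 * (ip d g v)\<^sup>2) - (l * ip d v x)\<^sup>2)"
    using expect_signs_ip_ip[of d "mv d A x" v] ip_eigen[of x]
    by (simp add: expect_add expect_diff ip_commute[of d "mv d A x"] power2_eq_square)
  also have "\<dots> \<le> \<eta>\<^sup>2 * (3 * energy x)"
    using expect_signs_ip_sq_ip_sq[of d "mv d A x" v] unit
    by (intro mult_left_mono) (auto intro: order_trans[rotated])
  finally show ?thesis by simp
qed

lemma expect_ip_run:
  "expect (replicate_pmf n (signs d)) (\<lambda>gs. ip d v (run d A \<eta> gs x)) = (1 + \<eta> * l) ^ n * ip d v x"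
proof (induction n arbitrary: x)
  case (Suc n)
  then show ?case
    by (simp add: expect_replicate_Suc[OF finite_set_signs] expect_ip_move del: replicate_pmf.simps)
qed simp

text \<open>The energy grows per step by at most \<open>\<rho> \<le> q\<close>, that is, hardly faster than the square of the
  mean growth \<open>\<gamma>\<close>; hence the noise added in all steps together is still small against \<open>\<gamma> ^ (2 * n)\<close>.\<close>

lemma expect_ip_run_deviation:
  defines "\<gamma> \<equiv> 1 + \<eta> * l"
  defines "q \<equiv> \<gamma>\<^sup>2 * (1 + 3 * \<eta>\<^sup>2 * frob2 d A)"
  shows "expect (replicate_pmf n (signs d)) (\<lambda>gs. (ip d v (run d A \<eta> gs x) - \<gamma> ^ n * ip d v x)\<^sup>2)
    \<le> 3 * \<eta>\<^sup>2 * n * q ^ n * energy x"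
proof (induction n arbitrary: x)
  case (Suc n)
  let ?R = "replicate_pmf n (signs d)"
  let ?c = "3 * \<eta>\<^sup>2 * frob2 d A"
  have c: "0 \<le> ?c" by (simp add: frob2_nonneg)
  have \<gamma>: "1 \<le> \<gamma>" using step_nonneg lambda_nonneg by (simp add: \<gamma>_def)
  have \<gamma>2: "\<gamma>\<^sup>2 = 1 + 2 * \<eta> * l + (\<eta> * l)\<^sup>2"
    by (simp add: \<gamma>_def power2_eq_square algebra_simps)
  have c_le: "?c \<le> \<gamma>\<^sup>2 * ?c"
    using c \<gamma> by (simp add: mult_right_mono[of 1 "\<gamma>\<^sup>2" ?c, simplified])
  have \<rho>_le: "\<rho> \<le> q"
  proof -
    have "\<rho> = 1 + 2 * \<eta> * l + ?c" "q = \<gamma>\<^sup>2 + \<gamma>\<^sup>2 * ?c"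
      by (simp_all add: \<rho>_def q_def distrib_left)
    then show ?thesis
      using c_le \<gamma>2 zero_le_power2[of "\<eta> * l"] by linarith
  qed
  have q: "\<gamma>\<^sup>2 \<le> q"
    unfolding q_def using mult_left_mono[of 1 "1 + ?c" "\<gamma>\<^sup>2"] c by simp
  have q1: "1 \<le> q" using q \<gamma> by (smt (verit) one_le_power)
  have mean0: "expect ?R (\<lambda>gs. ip d v (run d A \<eta> gs y) - \<gamma> ^ n * ip d v y) = 0" for y
    by (simp add: expect_diff expect_ip_run \<gamma>_def)
  \<comment> \<open>The noise of the first step. The total deviation is
    \<open>\<gamma> ^ n * b g\<close> plus the deviation of the remaining walk; given
    \<open>g\<close> the latter has mean 0, so the mixed term vanishes.\<close>
  define b where "b = (\<lambda>g. ip d v (move x g) - \<gamma> * ip d v x)"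
  have "expect (replicate_pmf (Suc n) (signs d)) (\<lambda>gs. (ip d v (run d A \<eta> gs x) - \<gamma> ^ Suc n * ip d v x)\<^sup>2)
      = expect (signs d) (\<lambda>g. expect ?R (\<lambda>gs. (ip d v (run d A \<eta> gs (move x g)) - \<gamma> ^ n * ip d v (move x g))\<^sup>2
          + 2 * \<gamma> ^ n * b g * (ip d v (run d A \<eta> gs (move x g)) - \<gamma> ^ n * ip d v (move x g))
          + (\<gamma> ^ n)\<^sup>2 * (b g)\<^sup>2))"
    unfolding expect_replicate_Suc[OF finite_set_signs] run.simps
    by (intro Bochner_Integration.integral_cong refl) (simp add: b_def power2_eq_square algebra_simps)
  also have "\<dots> = expect (signs d) (\<lambda>g. expect ?R (\<lambda>gs. (ip d v (run d A \<eta> gs (move x g)) - \<gamma> ^ n * ip d v (move x g))\<^sup>2)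
          + (\<gamma> ^ n)\<^sup>2 * (b g)\<^sup>2)"
    by (simp add: expect_add mean0)
  also have "\<dots> \<le> expect (signs d) (\<lambda>g. 3 * \<eta>\<^sup>2 * n * q ^ n * energy (move x g) + (\<gamma> ^ n)\<^sup>2 * (b g)\<^sup>2)"
    by (intro expect_mono finite_set_signs add_right_mono Suc.IH)
  also have "\<dots> = 3 * \<eta>\<^sup>2 * n * q ^ n * expect (signs d) (\<lambda>g. energy (move x g))
      + (\<gamma> ^ n)\<^sup>2 * expect (signs d) (\<lambda>g. (b g)\<^sup>2)"
    by (simp add: expect_add)
  \<comment> \<open>The remaining walk contributes \<open>n\<close> equal shares and the first step
    one more.\<close>
  also have "\<dots> \<le> 3 * \<eta>\<^sup>2 * n * q ^ n * (q * energy x) + q ^ Suc n * (3 * \<eta>\<^sup>2 * energy x)"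
  proof (intro add_mono mult_left_mono mult_mono)
    show "expect (signs d) (\<lambda>g. energy (move x g)) \<le> q * energy x"
      using expect_energy_move[of x] \<rho>_le mult_right_mono[OF \<rho>_le ip_self_nonneg[of d "mv d A x"]]
      by linarith
    show "expect (signs d) (\<lambda>g. (b g)\<^sup>2) \<le> 3 * \<eta>\<^sup>2 * energy x"
      unfolding b_def \<gamma>_def by (rule expect_ip_move_deviation)
    have "(\<gamma> ^ n)\<^sup>2 = (\<gamma>\<^sup>2) ^ n" by (simp add: mult.commute flip: power_mult)
    also have "\<dots> \<le> q ^ n" using q by (intro power_mono) auto
    also have "\<dots> \<le> q ^ Suc n" using q1 by (intro power_increasing) auto
    finally show "(\<gamma> ^ n)\<^sup>2 \<le> q ^ Suc n" .
  qed (use q1 in \<open>auto intro: expect_nonneg\<close>)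
  finally show ?case by (simp add: algebra_simps)
qed simp

end

end

section \<open>Success probability of the walk for both kinds of input\<close>

lemma exp_le_power:
  fixes y :: real
  assumes "0 \<le> y" "y \<le> 1"
  shows "exp (y * n / 2) \<le> (1 + y) ^ n"
proof -
  have "y\<^sup>2 \<le> y" using assms by (simp add: power2_eq_square mult_left_le)
  \<comment> \<open>From \<open>exp x \<le> 1 + x + x\<^sup>2\<close> at \<open>x = y / 2\<close>,
    which is at most \<open>1 + 3 * y / 4\<close>.\<close>
  then have "exp (y / 2) \<le> 1 + y"
    using exp_bound[of "y / 2"] assms by (simp add: power_divide)
  then have "exp (y / 2) ^ n \<le> (1 + y) ^ n" by (intro power_mono) auto
  moreover have "exp (y * n / 2) = exp (y / 2) ^ n"
    by (metis exp_of_nat_mult mult.commute times_divide_eq_right)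
  ultimately show ?thesis by simp
qed

text \<open>Used with \<open>c = 3 * \<eta>\<^sup>2 * frob2 d A\<close>; the bound
  \<open>6 / 500\<close> is 3 times the one that \<open>step_small\<close> supplies.\<close>

lemma one_plus_power_le_2:
  fixes c :: real
  assumes "0 \<le> c" "c * n \<le> 6 / 500"
  shows "(1 + c) ^ n \<le> 2"
proof -
  have "(1 + c) ^ n \<le> exp c ^ n"
    using assms(1) by (intro power_mono) auto
  also have "\<dots> = exp (c * n)" by (metis exp_of_nat_mult mult.commute)
  also have "\<dots> \<le> exp (6 / 500)" using assms(2) by simp
  also have "\<dots> \<le> 2"
    using exp_bound[of "6 / 500 :: real"] by (simp add: power2_eq_square)
  finally show ?thesis .
qed

text \<open>With \<open>l = 0\<close> there is no drift, so the expected squared norm at most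
  doubles; Markov with failure probability \<open>1 / 10\<close> gives the factor 20.\<close>

lemma prob_walk_psd:
  assumes sym: "\<And>i j. i < d \<Longrightarrow> j < d \<Longrightarrow> A i j = A j i"
    and "0 \<le> \<eta>" and psd: "\<And>y. 0 \<le> ip d y (mv d A y)"
    and small: "\<eta>\<^sup>2 * frob2 d A * n \<le> 2 / 500"
  shows "measure_pmf.prob (replicate_pmf n (signs d))
    {gs. \<not> frob2 d (walk_mat d A \<eta> gs) \<le> 20 * frob2 d A} \<le> 1 / 10"
proof -
  interpret query_walk d A \<eta> 0
    using assms by unfold_locales auto
  let ?e = "\<lambda>k i. if i = k then 1 else 0 :: real"
  let ?R = "replicate_pmf n (signs d)"
  have "expect ?R (\<lambda>gs. frob2 d (walk_mat d A \<eta> gs)) = (\<Sum>k<d. expect ?R (\<lambda>gs. energy (run d A \<eta> gs (?e k))))"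
    by (simp add: frob2_eq_sum_columns[of d "walk_mat d A \<eta> _"] mv_walk_mat expect_sum)
  also have "\<dots> \<le> (\<Sum>k<d. \<rho> ^ n * energy (?e k))"
    by (intro sum_mono expect_energy_run)
  also have "\<dots> = \<rho> ^ n * frob2 d A"
    by (simp add: frob2_eq_sum_columns[of d A] sum_distrib_left)
  also have "\<dots> \<le> 2 * frob2 d A"
  proof (rule mult_right_mono)
    have "(1 + 3 * (\<eta>\<^sup>2 * frob2 d A)) ^ n \<le> 2"
      using small by (intro one_plus_power_le_2) (auto simp: frob2_nonneg mult_ac)
    then show "\<rho> ^ n \<le> 2"
      by (simp add: \<rho>_def mult.assoc)
  qed (rule frob2_nonneg)
  finally have "expect ?R (\<lambda>gs. frob2 d (walk_mat d A \<eta> gs)) \<le> 1 / 10 * (20 * frob2 d A)"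
    by simp
  then have "measure_pmf.prob ?R {gs. 20 * frob2 d A < frob2 d (walk_mat d A \<eta> gs)} \<le> 1 / 10"
    by (intro prob_Markov) (simp_all add: frob2_nonneg)
  then show ?thesis by (simp add: not_le)
qed

text \<open>By Chebyshev, \<open>s gs\<close> is at least half its mean \<open>\<gamma> ^ n\<close>
  with probability at least \<open>9 / 10\<close>. Squaring that half costs a factor 4, and
  \<open>720 = 4 * 180\<close>.\<close>

lemma prob_walk_negative:
  assumes sym: "\<And>i j. i < d \<Longrightarrow> j < d \<Longrightarrow> A i j = A j i"
    and "0 \<le> \<eta>" "0 \<le> l" and lower: "\<And>y. - l * ip d y y \<le> ip d y (mv d A y)"
    and unit: "ip d v v = 1" and eigen: "\<And>i. i < d \<Longrightarrow> mv d A v i = - l * v i"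
    and small: "\<eta>\<^sup>2 * frob2 d A * n \<le> 2 / 500"
    and large: "720 * frob2 d A < l\<^sup>2 * (1 + \<eta> * l) ^ (2 * n)"
  shows "measure_pmf.prob (replicate_pmf n (signs d))
    {gs. \<not> 180 * frob2 d A < frob2 d (walk_mat d A \<eta> gs)} \<le> 1 / 10"
proof -
  interpret query_walk d A \<eta> l
    using assms by unfold_locales auto
  let ?R = "replicate_pmf n (signs d)"
  define \<gamma> where "\<gamma> = 1 + \<eta> * l"
  define c where "c = 3 * \<eta>\<^sup>2 * frob2 d A"
  define s where "s = (\<lambda>gs. ip d v (run d A \<eta> gs v))"
  have \<gamma>: "0 < \<gamma>" using \<open>0 \<le> \<eta>\<close> \<open>0 \<le> l\<close> by (simp add: \<gamma>_def add_pos_nonneg)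
  have \<gamma>2n: "(\<gamma> ^ n)\<^sup>2 = (\<gamma>\<^sup>2) ^ n" "\<gamma> ^ (2 * n) = (\<gamma> ^ n)\<^sup>2"
    by (simp_all add: mult.commute flip: power_mult)
  have l_le: "l\<^sup>2 \<le> frob2 d A"
    using energy_eigen[OF unit eigen] ip_mv_self_le[of d A v] unit by simp
  have c: "0 \<le> c" by (simp add: c_def frob2_nonneg)
  have "expect ?R (\<lambda>gs. (s gs - \<gamma> ^ n)\<^sup>2) \<le> 3 * \<eta>\<^sup>2 * n * (\<gamma>\<^sup>2 * (1 + c)) ^ n * l\<^sup>2"
    using expect_ip_run_deviation[OF unit eigen, of n v] energy_eigen[OF unit eigen] unit
    by (simp add: s_def \<gamma>_def c_def)
  also have "\<dots> = (3 * \<eta>\<^sup>2 * l\<^sup>2 * n) * (1 + c) ^ n * (\<gamma> ^ n)\<^sup>2"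
    by (simp add: power_mult_distrib \<gamma>2n)
  also have "\<dots> \<le> (6 / 500) * 2 * (\<gamma> ^ n)\<^sup>2"
  proof (intro mult_right_mono mult_mono)
    have "\<eta>\<^sup>2 * l\<^sup>2 * n \<le> \<eta>\<^sup>2 * frob2 d A * n"
      using l_le by (intro mult_right_mono mult_left_mono) auto
    then show "3 * \<eta>\<^sup>2 * l\<^sup>2 * n \<le> 6 / 500"
      using small unfolding mult.assoc by linarith
    show "(1 + c) ^ n \<le> 2"
      using c small by (intro one_plus_power_le_2) (simp_all add: c_def mult_ac)
  qed (use c in auto)
  \<comment> \<open>Here 0.024 meets 0.025; the constant 500 in \<open>step\<close> makes this
    fit.\<close>
  also have "\<dots> \<le> 1 / 10 * ((\<gamma> ^ n)\<^sup>2 / 4)" by simp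
  finally have "measure_pmf.prob ?R {gs. (\<gamma> ^ n)\<^sup>2 / 4 < (s gs - \<gamma> ^ n)\<^sup>2} \<le> 1 / 10"
    by (intro prob_Markov) simp_all
  moreover have "180 * frob2 d A < frob2 d (walk_mat d A \<eta> gs)"
    if "(s gs - \<gamma> ^ n)\<^sup>2 \<le> (\<gamma> ^ n)\<^sup>2 / 4" for gs
  proof -
    have "\<bar>s gs - \<gamma> ^ n\<bar> \<le> \<bar>\<gamma> ^ n / 2\<bar>"
      using that by (simp only: abs_le_square_iff) (simp add: power_divide)
    then have "\<gamma> ^ n / 2 \<le> s gs"
      using zero_less_power[OF \<gamma>, of n] by (simp only: abs_le_iff) linarith
    then have "(\<gamma> ^ n / 2)\<^sup>2 \<le> (s gs)\<^sup>2"
      using \<gamma> by (intro power_mono) auto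
    then have "l\<^sup>2 * ((\<gamma> ^ n)\<^sup>2 / 4) \<le> l\<^sup>2 * (s gs)\<^sup>2"
      by (intro mult_left_mono) (simp_all add: power_divide)
    \<comment> \<open>Since \<open>v\<close> is an eigenvector of the symmetric \<open>A\<close>,
      testing the walk matrix against \<open>v\<close> on both sides gives
      \<open>- l * s gs\<close>.\<close>
    also have "\<dots> = (ip d v (mv d A (run d A \<eta> gs v)))\<^sup>2"
      by (simp add: s_def ip_eigen[OF unit eigen] power_mult_distrib)
    also have "\<dots> \<le> ip d v v * ip d (mv d A (run d A \<eta> gs v)) (mv d A (run d A \<eta> gs v))"
      by (rule ip_Cauchy_Schwarz)
    also have "\<dots> \<le> frob2 d (walk_mat d A \<eta> gs)"
      using ip_mv_self_le[of d "walk_mat d A \<eta> gs" v] unit by (simp add: mv_walk_mat)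
    finally show ?thesis
      using large by (simp add: \<gamma>2n flip: \<gamma>_def)
  qed
  then have "{gs. \<not> 180 * frob2 d A < frob2 d (walk_mat d A \<eta> gs)} \<subseteq> {gs. (\<gamma> ^ n)\<^sup>2 / 4 < (s gs - \<gamma> ^ n)\<^sup>2}"
    by (auto simp: not_less) (meson not_le)
  then have "measure_pmf.prob ?R {gs. \<not> 180 * frob2 d A < frob2 d (walk_mat d A \<eta> gs)}
      \<le> measure_pmf.prob ?R {gs. (\<gamma> ^ n)\<^sup>2 / 4 < (s gs - \<gamma> ^ n)\<^sup>2}"
    by (intro measure_pmf.finite_measure_mono) auto
  ultimately show ?thesis by linarith
qed

section \<open>The tester\<close>

text \<open>Written with a continuation \<open>k\<close>, because later queries depend on the
  position that the walk reaches.\<close>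

primrec walk_alg :: "nat \<Rightarrow> real \<Rightarrow> (nat \<Rightarrow> real) list \<Rightarrow> ((nat \<Rightarrow> real) \<Rightarrow> vmv_alg) \<Rightarrow> (nat \<Rightarrow> real) \<Rightarrow> vmv_alg" where
  "walk_alg d \<eta> [] k x = k x"
| "walk_alg d \<eta> (g # gs) k x = Query (vec d g) (vec d x) (\<lambda>r. walk_alg d \<eta> gs k (\<lambda>i. x i - \<eta> * r * g i))"

text \<open>The same \<open>gs\<close> is replayed for every pair, so all samples concern one and
  the same walk matrix.\<close>

primrec sketch_alg :: "nat \<Rightarrow> real \<Rightarrow> (nat \<Rightarrow> real) list \<Rightarrow> (real \<Rightarrow> vmv_alg)
    \<Rightarrow> ((nat \<Rightarrow> real) \<times> (nat \<Rightarrow> real)) list \<Rightarrow> real \<Rightarrow> vmv_alg" where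
  "sketch_alg d \<eta> gs k [] s = k s"
| "sketch_alg d \<eta> gs k (z # zs) s =
     walk_alg d \<eta> gs (\<lambda>x. Query (vec d (fst z)) (vec d x) (\<lambda>r. sketch_alg d \<eta> gs k zs (s + r\<^sup>2))) (snd z)"

text \<open>Here \<open>f\<close> is the estimate of \<open>frob2 d A\<close> and \<open>n\<close> the number of walk steps. For \<open>f = 0\<close> or
  \<open>n = 0\<close> the step size is \<open>0\<close>.\<close>

definition step :: "real \<Rightarrow> nat \<Rightarrow> real" where
  "step f n = sqrt (1 / (500 * n * f))"

text \<open>The outer sketch estimates \<open>f = frob2 d A\<close>, since a walk without steps is the identity; the
  inner one estimates \<open>frob2 d (A P)\<close> for the walk \<open>P\<close> given by \<open>gs\<close>. For positive semidefinite
  \<open>A\<close> the latter is at most \<open>20\<close> times, for far \<open>A\<close> more than \<open>180\<close> times the former with high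
  probability; as each estimate is off by a factor in \<open>[1/2, 3/2]\<close>, the threshold \<open>60\<close> separates
  the cases.\<close>

fun tester :: "nat \<Rightarrow> ((nat \<Rightarrow> real) \<times> (nat \<Rightarrow> real)) list \<times> (nat \<Rightarrow> real) list \<times> ((nat \<Rightarrow> real) \<times> (nat \<Rightarrow> real)) list \<Rightarrow> vmv_alg" where
  "tester d (zs, gs, ws) = sketch_alg d 0 [] (\<lambda>s. sketch_alg d (step (s / length zs) (length gs)) gs
     (\<lambda>t. Output (t / length ws \<le> 60 * (s / length zs))) ws 0) zs 0"

lemma query_answer:
  assumes "A \<in> carrier_mat d d"
  shows "vec d v \<bullet> (A *\<^sub>v vec d w) = ip d v (mv d (entries A) w)"
  using assms by (simp add: scalar_prod_def ip_def mv_def atLeast0LessThan)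

lemma valid_walk_alg: "(\<And>x. valid_queries d (k x)) \<Longrightarrow> valid_queries d (walk_alg d \<eta> gs k x)"
  by (induction gs arbitrary: x) auto

lemma valid_sketch_alg: "(\<And>s. valid_queries d (k s)) \<Longrightarrow> valid_queries d (sketch_alg d \<eta> gs k zs s)"
  by (induction zs arbitrary: s) (auto intro!: valid_walk_alg)

lemma valid_tester: "valid_queries d (tester d s)"
  by (cases s) (auto intro!: valid_sketch_alg)

context
  fixes A :: "real mat" and d :: nat
  assumes A: "A \<in> carrier_mat d d"
begin

lemma accepts_walk_alg: "accepts A (walk_alg d \<eta> gs k x) = accepts A (k (run d (entries A) \<eta> gs x))"
  by (induction gs arbitrary: x) (auto simp: query_answer[OF A])

lemma num_queries_walk_alg:
  "num_queries A (walk_alg d \<eta> gs k x) = length gs + num_queries A (k (run d (entries A) \<eta> gs x))"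
  by (induction gs arbitrary: x) (auto simp: query_answer[OF A])

lemma accepts_sketch_alg:
  "accepts A (sketch_alg d \<eta> gs k zs s)
    = accepts A (k (s + sum_list (map (sketch d (walk_mat d (entries A) \<eta> gs)) zs)))"
  by (induction zs arbitrary: s)
     (auto simp: query_answer[OF A] accepts_walk_alg sketch_def mv_walk_mat add.assoc case_prod_beta)

text \<open>The final sum is left existential: the continuations in \<open>tester\<close> make
  equally many queries for every value.\<close>

lemma num_queries_sketch_alg:
  "\<exists>t. num_queries A (sketch_alg d \<eta> gs k zs s) = length zs * (length gs + 1) + num_queries A (k t)"
proof (induction zs arbitrary: s)
  case (Cons z zs)
  show ?case
    using Cons.IH[of "s + (ip d (fst z) (mv d (entries A) (run d (entries A) \<eta> gs (snd z))))\<^sup>2"]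
    by (auto simp: query_answer[OF A] num_queries_walk_alg)
qed auto

lemma accepts_tester:
  "accepts A (tester d (zs, gs, ws)) \<longleftrightarrow>
     avg (sketch d (walk_mat d (entries A) (step (avg (sketch d (entries A)) zs) (length gs)) gs)) ws
       \<le> 60 * avg (sketch d (entries A)) zs"
  by (simp add: accepts_sketch_alg avg_def)

lemma num_queries_tester:
  "num_queries A (tester d (zs, gs, ws)) = length zs + length ws * (length gs + 1)"
proof -
  let ?k = "\<lambda>s. sketch_alg d (step (s / length zs) (length gs)) gs
     (\<lambda>t. Output (t / length ws \<le> 60 * (s / length zs))) ws 0"
  obtain s where "num_queries A (tester d (zs, gs, ws)) = length zs + num_queries A (?k s)"
    using num_queries_sketch_alg[of 0 "[]" ?k zs 0] by auto
  moreover have "num_queries A (?k s) = length ws * (length gs + 1)"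
    using num_queries_sketch_alg[of _ gs "\<lambda>t. Output (t / length ws \<le> 60 * (s / length zs))" ws 0] by fastforce
  ultimately show ?thesis by simp
qed

end

section \<open>The law of the seeds and the error probability\<close>

text \<open>The order of the draws follows the dependence: \<open>zs\<close> fixes the step size,
  \<open>zs\<close> and \<open>gs\<close> fix the walk matrix, and \<open>ws\<close> estimates its
  norm. With 400 samples a sketch fails with probability at most 0.08.\<close>

definition seeds :: "nat \<Rightarrow> nat \<Rightarrow> (((nat \<Rightarrow> real) \<times> (nat \<Rightarrow> real)) list \<times> (nat \<Rightarrow> real) list \<times> ((nat \<Rightarrow> real) \<times> (nat \<Rightarrow> real)) list) pmf" where
  "seeds d n = bind_pmf (replicate_pmf 400 (sign_pairs d)) (\<lambda>zs. bind_pmf (replicate_pmf n (signs d))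
     (\<lambda>gs. map_pmf (\<lambda>ws. (zs, gs, ws)) (replicate_pmf 400 (sign_pairs d))))"

lemma finite_set_seeds: "finite (set_pmf (seeds d n))"
  by (auto simp: seeds_def)

lemma set_seeds: "(zs, gs, ws) \<in> set_pmf (seeds d n) \<Longrightarrow> length zs = 400 \<and> length gs = n \<and> length ws = 400"
  by (auto simp: seeds_def set_replicate_pmf)

text \<open>Serves both kinds of input: \<open>b\<close> is the correct answer and
  \<open>good\<close> the typical range of the walk matrix's squared norm. The three failures add up
  to 0.26.\<close>

lemma prob_tester_wrong:
  fixes A :: "real mat" and b :: bool
  assumes A: "A \<in> carrier_mat d d"
    and walk: "\<And>f. \<bar>f - frob2 d (entries A)\<bar> \<le> frob2 d (entries A) / 2 \<Longrightarrow>
      measure_pmf.prob (replicate_pmf n (signs d)) {gs. \<not> good (frob2 d (walk_mat d (entries A) (step f n) gs))} \<le> 1 / 10"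
    and answer: "\<And>e f B. good B \<Longrightarrow> \<bar>e - B\<bar> \<le> B / 2 \<Longrightarrow>
      \<bar>f - frob2 d (entries A)\<bar> \<le> frob2 d (entries A) / 2 \<Longrightarrow> (e \<le> 60 * f) = b"
  shows "measure_pmf.prob (seeds d n) {s. accepts A (tester d s) \<noteq> b} \<le> 1 / 3"
proof -
  let ?F = "frob2 d (entries A)" and ?P = "replicate_pmf 400 (sign_pairs d)"
  have "measure_pmf.prob (seeds d n) {s. accepts A (tester d s) \<noteq> b} \<le> 32 / 400 + (1 / 10 + 32 / 400)"
    unfolding seeds_def
  proof (rule prob_bind_le)
    show "measure_pmf.prob ?P {zs. \<not> \<bar>avg (sketch d (entries A)) zs - ?F\<bar> \<le> ?F / 2} \<le> 32 / 400"
      using prob_avg_sketch[of 400 d "entries A"] by simp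
    fix zs
    assume zs: "\<bar>avg (sketch d (entries A)) zs - ?F\<bar> \<le> ?F / 2"
    define f where "f = avg (sketch d (entries A)) zs"
    let ?W = "\<lambda>gs. walk_mat d (entries A) (step f n) gs"
    show "measure_pmf.prob (bind_pmf (replicate_pmf n (signs d)) (\<lambda>gs. map_pmf (\<lambda>ws. (zs, gs, ws)) ?P))
        {s. accepts A (tester d s) \<noteq> b} \<le> 1 / 10 + 32 / 400"
    proof (rule prob_bind_le)
      show "measure_pmf.prob (replicate_pmf n (signs d)) {gs. \<not> good (frob2 d (?W gs))} \<le> 1 / 10"
        using walk zs by (simp add: f_def)
      fix gs
      assume gs: "gs \<in> set_pmf (replicate_pmf n (signs d))" "good (frob2 d (?W gs))"
      have "accepts A (tester d (zs, gs, ws)) = b"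
        if "\<bar>avg (sketch d (?W gs)) ws - frob2 d (?W gs)\<bar> \<le> frob2 d (?W gs) / 2" for ws
        using answer[OF gs(2) that] zs gs(1) by (simp add: accepts_tester[OF A] f_def set_replicate_pmf del: tester.simps)
      then have "measure_pmf.prob (map_pmf (\<lambda>ws. (zs, gs, ws)) ?P) {s. accepts A (tester d s) \<noteq> b}
          \<le> measure_pmf.prob ?P {ws. \<not> \<bar>avg (sketch d (?W gs)) ws - frob2 d (?W gs)\<bar> \<le> frob2 d (?W gs) / 2}"
        by (auto intro!: measure_pmf.finite_measure_mono simp del: tester.simps)
      also have "\<dots> \<le> 32 / 400"
        using prob_avg_sketch[of 400 d "?W gs"] by simp
      finally show "measure_pmf.prob (map_pmf (\<lambda>ws. (zs, gs, ws)) ?P) {s. accepts A (tester d s) \<noteq> b} \<le> 32 / 400" .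
    qed simp_all
  qed simp_all
  then show ?thesis by simp
qed

section \<open>The step size against the noise and the drift\<close>

lemma step_nonneg: "0 \<le> f \<Longrightarrow> 0 \<le> step f n"
  by (simp add: step_def)

text \<open>The estimate satisfies \<open>F \<le> 2 * f\<close>, whence the factor 2.\<close>

lemma step_small:
  assumes "\<bar>f - F\<bar> \<le> F / 2" "0 \<le> F"
  shows "(step f n)\<^sup>2 * F * n \<le> 2 / 500"
proof (cases "F = 0 \<or> n = 0")
  case False
  then have "0 < F" "0 < n" using assms(2) by auto
  then have "0 < f" "F \<le> 2 * f" using assms(1) by linarith+
  then have "(step f n)\<^sup>2 = 1 / (500 * n * f)"
    by (simp add: step_def)
  then have "(step f n)\<^sup>2 * F * n = 1 / (500 * n * f) * F * n"
    by (simp only:)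
  also have "\<dots> = F / (500 * f)"
    using \<open>0 < n\<close> by simp
  also have "\<dots> \<le> 2 / 500"
    using \<open>0 < f\<close> \<open>F \<le> 2 * f\<close> by (simp add: divide_le_eq)
  finally show ?thesis .
qed auto

text \<open>With \<open>y\<close> below the drift per step, \<open>steps\<close> says that
  \<open>y * n\<close> is at least \<open>ln (1000 / \<epsilon>\<^sup>2)\<close>. The walk thus
  gains the factor \<open>1000 / \<epsilon>\<^sup>2\<close>, which makes up for
  \<open>l\<^sup>2\<close> being possibly as small as \<open>\<epsilon>\<^sup>2 * F\<close>.\<close>

lemma step_large:
  assumes f: "\<bar>f - F\<bar> \<le> F / 2" and F: "0 < F" and n: "0 < n" and \<epsilon>: "0 < \<epsilon>" "\<epsilon> \<le> 1 / 2"
    and l: "\<epsilon> * sqrt F \<le> l" and steps: "1000 * (ln (1000 / \<epsilon>\<^sup>2))\<^sup>2 / \<epsilon>\<^sup>2 \<le> n"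
  shows "720 * F < l\<^sup>2 * (1 + step f n * l) ^ (2 * n)"
proof -
  \<comment> \<open>The value of \<open>step f n * l\<close> at the extremes
    \<open>f = 2 * F\<close> and \<open>l = \<epsilon> * sqrt F\<close>. Unlike the true drift, it
    is at most 1, as \<open>exp_le_power\<close> demands.\<close>
  define y where "y = \<epsilon> / sqrt (1000 * real n)"
  have f': "0 < f" "f \<le> 2 * F" using f F by linarith+
  have "y \<le> step f n * (\<epsilon> * sqrt F)"
  proof -
    have "1 / (1000 * real n) = F / (500 * real n * (2 * F))"
      using F by simp
    also have "\<dots> \<le> F / (500 * real n * f)"
      using f' F n by (intro divide_left_mono mult_left_mono mult_pos_pos) auto
    finally have "sqrt (1 / (1000 * real n)) \<le> sqrt (1 / (500 * real n * f) * F)"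
      by (intro real_sqrt_le_mono) simp
    then have "sqrt (1 / (1000 * real n)) \<le> step f n * sqrt F"
      by (simp only: step_def real_sqrt_mult)
    then have "\<epsilon> * sqrt (1 / (1000 * real n)) \<le> \<epsilon> * (step f n * sqrt F)"
      using \<epsilon> by (intro mult_left_mono) auto
    moreover have "y = \<epsilon> * sqrt (1 / (1000 * real n))"
      by (simp add: y_def real_sqrt_divide)
    ultimately show ?thesis by (simp only: mult.left_commute)
  qed
  also have "\<dots> \<le> step f n * l"
    using l f' by (intro mult_left_mono) (auto simp: step_def)
  finally have y_le: "y \<le> step f n * l" .
  have "1 \<le> sqrt (1000 * real n)" using n by simp
  then have "\<epsilon> \<le> sqrt (1000 * real n)" using \<epsilon> by linarith
  then have y: "0 \<le> y" "y \<le> 1"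
    using \<epsilon> by (simp_all add: y_def divide_le_eq)
  have "y\<^sup>2 = \<epsilon>\<^sup>2 / (1000 * real n)" by (simp add: y_def power_divide)
  then have "(y * n)\<^sup>2 = \<epsilon>\<^sup>2 / (1000 * real n) * (real n)\<^sup>2"
    by (simp only: power_mult_distrib)
  also have "\<dots> = n * \<epsilon>\<^sup>2 / 1000"
    using n by (simp add: power2_eq_square)
  finally have yn: "(y * n)\<^sup>2 = n * \<epsilon>\<^sup>2 / 1000" .
  have "1000 * (ln (1000 / \<epsilon>\<^sup>2))\<^sup>2 \<le> n * \<epsilon>\<^sup>2"
    using steps \<epsilon> by (simp only: pos_divide_le_eq zero_less_power)
  then have "(ln (1000 / \<epsilon>\<^sup>2))\<^sup>2 \<le> (y * n)\<^sup>2"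
    unfolding yn by linarith
  then have "ln (1000 / \<epsilon>\<^sup>2) \<le> y * n"
    by (rule power2_le_imp_le) (simp add: y)
  then have "exp (ln (1000 / \<epsilon>\<^sup>2)) \<le> exp (y * n)" by simp
  then have "1000 / \<epsilon>\<^sup>2 \<le> exp (y * (2 * n) / 2)"
    using \<epsilon> by simp
  also have "\<dots> \<le> (1 + y) ^ (2 * n)"
    using exp_le_power[OF y, of "2 * n"] by simp
  also have "\<dots> \<le> (1 + step f n * l) ^ (2 * n)"
    using y y_le by (intro power_mono) auto
  finally have pow: "1000 / \<epsilon>\<^sup>2 \<le> (1 + step f n * l) ^ (2 * n)" .
  have "(\<epsilon> * sqrt F)\<^sup>2 \<le> l\<^sup>2"
    using l \<epsilon> F by (intro power_mono) auto
  then have "\<epsilon>\<^sup>2 * F \<le> l\<^sup>2" using F by (simp add: power_mult_distrib)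
  then have "\<epsilon>\<^sup>2 * F * (1000 / \<epsilon>\<^sup>2) \<le> l\<^sup>2 * (1 + step f n * l) ^ (2 * n)"
    using pow F \<epsilon> by (intro mult_mono) auto
  then show ?thesis using \<epsilon> F by simp
qed

text \<open>Seeds are coded injectively as natural numbers, written on the first cell of the tape.\<close>

lemma psd_tester_of_pmf:
  fixes p :: "'s pmf"
  assumes fin: "finite (set_pmf p)"
    and valid: "\<And>s. s \<in> set_pmf p \<Longrightarrow> valid_queries d (T s)"
    and queries: "\<And>s A. s \<in> set_pmf p \<Longrightarrow> A \<in> symmetric_mats d \<Longrightarrow> real (num_queries A (T s)) \<le> q"
    and psd: "\<And>A. A \<in> symmetric_mats d \<Longrightarrow> psd A \<Longrightarrow> measure_pmf.prob p {s. \<not> accepts A (T s)} \<le> 1 / 3"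
    and far: "\<And>A. A \<in> symmetric_mats d \<Longrightarrow> A \<noteq> 0\<^sub>m d d \<Longrightarrow> lambda_min A \<le> - \<epsilon> * schatten_norm r A \<Longrightarrow>
      measure_pmf.prob p {s. accepts A (T s)} \<le> 1 / 3"
  shows "\<exists>M T'. psd_tester \<epsilon> r d M T' \<and> at_most_queries d M T' q"
proof -
  obtain c :: "'s \<Rightarrow> nat" where c: "inj_on c (set_pmf p)"
    using finite_imp_inj_to_nat_seg[OF fin] by blast
  obtain s0 where s0: "s0 \<in> set_pmf p" using set_pmf_not_empty[of p] by blast
  define code where "code = (\<lambda>s. real (c s))"
  \<comment> \<open>Tapes without a code fall back to a seed of the support, so that validity and
    the query bound hold for every tape, not just almost surely.\<close>
  define decode where "decode = (\<lambda>x. if x \<in> code ` set_pmf p then inv_into (set_pmf p) code x else s0)"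
  define Q where "Q = (PiM UNIV (\<lambda>_. borel) :: coins measure)"
  define M where "M = distr (measure_pmf p) Q (\<lambda>s _. code s)"
  define T' where "T' = (\<lambda>\<omega> :: coins. T (decode (\<omega> 0)))"
  have inj: "inj_on code (set_pmf p)" using c by (auto simp: inj_on_def code_def)
  have decode_in: "decode x \<in> set_pmf p" for x
    using s0 by (auto simp: decode_def inv_into_into)
  have decode_code: "decode (code s) = s" if "s \<in> set_pmf p" for s
    using that inj by (simp add: decode_def)
  have emb: "(\<lambda>s _. code s) \<in> measurable (measure_pmf p) Q"
    unfolding Q_def by (intro measurable_PiM_single') auto
  have space_M: "space M = UNIV" and sets_M: "sets M = sets Q"
    by (simp_all add: M_def Q_def space_PiM)
  have meas: "{\<omega>. P (T' \<omega>)} \<in> sets Q" for P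
  proof -
    \<comment> \<open>A finite set of codes, possibly joined with the complement of a finite set;
      both are Borel.\<close>
    have "{x. P (T (decode x))} = code ` {s \<in> set_pmf p. P (T s)} \<union> (if P (T s0) then - code ` set_pmf p else {})"
      using inj by (auto simp: decode_def inv_into_into image_iff dest: inj_onD[OF inj])
    moreover have "code ` {s \<in> set_pmf p. P (T s)} \<in> sets borel" "code ` set_pmf p \<in> sets borel"
      using fin by (auto intro!: borel_closed finite_imp_closed)
    ultimately have "{x. P (T (decode x))} \<in> sets borel" by auto
    moreover have "(\<lambda>\<omega>. \<omega> 0) \<in> measurable Q borel"
      unfolding Q_def by (rule measurable_component_singleton) simp
    ultimately have "(\<lambda>\<omega>. \<omega> 0) -` {x. P (T (decode x))} \<inter> space Q \<in> sets Q"
      by (rule measurable_sets[rotated])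
    then show ?thesis by (simp add: T'_def Q_def space_PiM vimage_def)
  qed
  have prob_M: "measure M {\<omega> \<in> space M. P (T' \<omega>)} = 1 - measure_pmf.prob p {s. \<not> P (T s)}" for P
  proof -
    have "measure M {\<omega> \<in> space M. P (T' \<omega>)} = measure_pmf.prob p {s. P (T (decode (code s)))}"
      unfolding M_def using emb meas[of P] by (subst measure_distr) (simp_all add: T'_def Q_def space_PiM vimage_def)
    also have "\<dots> = measure_pmf.prob p {s. P (T s)}"
      by (intro measure_pmf.finite_measure_eq_AE) (auto simp: AE_measure_pmf_iff decode_code)
    also have "\<dots> = 1 - measure_pmf.prob p {s. \<not> P (T s)}"
      using measure_pmf.prob_compl[of "{s. \<not> P (T s)}" p] by (simp add: Compl_eq_Diff_UNIV[symmetric] Collect_neg_eq[symmetric])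
    finally show ?thesis .
  qed
  have "randomized_vmv_alg d M T'"
    unfolding randomized_vmv_alg_def
  proof (intro conjI ballI)
    show "prob_space M"
      unfolding M_def by (rule measure_pmf.prob_space_distr[OF emb])
    show "sets M = sets (PiM UNIV (\<lambda>_. borel))"
      by (simp add: sets_M Q_def)
    show "valid_queries d (T' \<omega>)" for \<omega>
      by (simp add: T'_def valid decode_in)
    show "(\<lambda>\<omega>. accepts A (T' \<omega>)) \<in> measurable M (count_space UNIV)" for A
      using meas[of "accepts A"] by (simp add: pred_def space_M sets_M)
  qed
  moreover have "2 / 3 \<le> measure M {\<omega> \<in> space M. accepts A (T' \<omega>)}" if "A \<in> symmetric_mats d" "psd A" for A
    unfolding prob_M[of "accepts A"] using psd[OF that] by simp
  moreover have "2 / 3 \<le> measure M {\<omega> \<in> space M. \<not> accepts A (T' \<omega>)}"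
    if "A \<in> symmetric_mats d" "A \<noteq> 0\<^sub>m d d" "lambda_min A \<le> - \<epsilon> * schatten_norm r A" for A
    unfolding prob_M[of "\<lambda>t. \<not> accepts A t"] using far[OF that] by simp
  ultimately have "psd_tester \<epsilon> r d M T'"
    unfolding psd_tester_def by blast
  moreover have "at_most_queries d M T' q"
    unfolding at_most_queries_def T'_def using queries[OF decode_in] by blast
  ultimately show ?thesis by blast
qed

section \<open>The number of walk steps and the final assembly\<close>

definition rounds :: "real \<Rightarrow> nat" where
  "rounds \<epsilon> = nat \<lceil>1000 * (ln (1000 / \<epsilon>\<^sup>2))\<^sup>2 / \<epsilon>\<^sup>2\<rceil>"

text \<open>The first two facts feed \<open>step_large\<close>. The third bounds the query count:
  400 for the plain sketch and 400 times \<open>rounds \<epsilon> + 1\<close> for the walk.\<close>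

lemma rounds_bound:
  assumes \<epsilon>: "0 < \<epsilon>" "\<epsilon> \<le> 1 / 2"
  shows "1000 * (ln (1000 / \<epsilon>\<^sup>2))\<^sup>2 / \<epsilon>\<^sup>2 \<le> rounds \<epsilon>" "0 < rounds \<epsilon>"
    "800 + 400 * real (rounds \<epsilon>) \<le> 10 ^ 9 * (1 / \<epsilon>\<^sup>2) * ln (1 / \<epsilon>) powr 2"
proof -
  define L where "L = ln (1 / \<epsilon>)"
  define X where "X = 1000 * (ln (1000 / \<epsilon>\<^sup>2))\<^sup>2 / \<epsilon>\<^sup>2"
  have "ln 2 \<le> L" using \<epsilon> by (simp add: L_def le_divide_eq)
  then have L: "1 / 2 \<le> L" using ln2_ge_two_thirds by linarith
  \<comment> \<open>As \<open>\<epsilon> \<le> 1 / 2\<close>, the logarithm \<open>L\<close> is at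
    least \<open>ln 2\<close>, so constants such as \<open>ln 1000\<close> are absorbed into
    multiples of \<open>L\<close>.\<close>
  have "ln (1000 :: real) \<le> ln (2 ^ 10)" by (subst ln_le_cancel_iff) simp_all
  also have "ln (2 ^ 10 :: real) = 10 * ln 2" by (subst ln_realpow) simp_all
  finally have "ln (1000 :: real) \<le> 10 * L" using \<open>ln 2 \<le> L\<close> by linarith
  moreover have eq: "ln (1000 / \<epsilon>\<^sup>2) = ln 1000 + 2 * L"
    using \<epsilon> by (simp add: L_def ln_div ln_realpow)
  moreover have "0 < ln (1000 :: real)" by simp
  ultimately have ln: "ln (1000 / \<epsilon>\<^sup>2) \<le> 12 * L" "0 < ln (1000 / \<epsilon>\<^sup>2)" using L by linarith+
  then have "(ln (1000 / \<epsilon>\<^sup>2))\<^sup>2 \<le> (12 * L)\<^sup>2" by (intro power_mono) auto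
  then have "X \<le> 1000 * (144 * L\<^sup>2) / \<epsilon>\<^sup>2"
    unfolding X_def by (intro divide_right_mono) (auto simp: power_mult_distrib)
  then have X_le: "X \<le> 144000 * ((1 / \<epsilon>\<^sup>2) * L\<^sup>2)" by simp
  have X_pos: "0 < X" using ln \<epsilon> by (simp add: X_def)
  have n: "real (rounds \<epsilon>) \<le> X + 1" "X \<le> rounds \<epsilon>"
    using X_pos by (auto simp: rounds_def simp flip: X_def)
  show "1000 * (ln (1000 / \<epsilon>\<^sup>2))\<^sup>2 / \<epsilon>\<^sup>2 \<le> rounds \<epsilon>" using n(2) by (simp add: X_def)
  show "0 < rounds \<epsilon>" using n(2) X_pos by (metis not_gr0 not_less of_nat_0)
  \<comment> \<open>A positive lower bound for the main term, which absorbs the additive constants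
    from the rounding and from the 800 further queries.\<close>
  have "1 * (1 / 4) \<le> (1 / \<epsilon>\<^sup>2) * L\<^sup>2"
  proof (rule mult_mono)
    show "1 \<le> 1 / \<epsilon>\<^sup>2" using \<epsilon> by (simp add: power_le_one)
    show "1 / 4 \<le> L\<^sup>2" using power_mono[OF L, of 2] by (simp add: power_divide)
  qed auto
  then have "800 + 400 * real (rounds \<epsilon>) \<le> 1000000000 * ((1 / \<epsilon>\<^sup>2) * L\<^sup>2)"
    using n(1) X_le by linarith
  moreover have "L powr 2 = L\<^sup>2" using L by simp
  ultimately show "800 + 400 * real (rounds \<epsilon>) \<le> 10 ^ 9 * (1 / \<epsilon>\<^sup>2) * ln (1 / \<epsilon>) powr 2"
    by (simp add: L_def)
qed

lemma psd_ip_nonneg: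
  assumes "psd A" "A \<in> carrier_mat d d"
  shows "0 \<le> ip d y (mv d (entries A) y)"
proof -
  have "vec d y \<in> carrier_vec (dim_row A)" using assms(2) by simp
  then show ?thesis
    using assms(1) by (metis psd_def query_answer[OF assms(2)])
qed

theorem theorem29:
  shows "\<exists>C a :: real. C > 0 \<and> a > 0 \<and>
    (\<forall>(d :: nat) (\<epsilon> :: real). d \<ge> 1 \<and> 0 < \<epsilon> \<and> \<epsilon> \<le> 1 / 2 \<longrightarrow>
      (\<exists>M T. psd_tester \<epsilon> 2 d M T \<and>
        at_most_queries d M T (C * (1 / \<epsilon>\<^sup>2) * ln (1 / \<epsilon>) powr a)))"
proof -
  have "\<exists>M T. psd_tester \<epsilon> 2 d M T \<and> at_most_queries d M T (10 ^ 9 * (1 / \<epsilon>\<^sup>2) * ln (1 / \<epsilon>) powr 2)"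
    if d: "1 \<le> d" and \<epsilon>: "0 < \<epsilon>" "\<epsilon> \<le> 1 / 2" for d :: nat and \<epsilon> :: real
  proof (rule psd_tester_of_pmf[where p = "seeds d (rounds \<epsilon>)" and T = "tester d"])
    show "finite (set_pmf (seeds d (rounds \<epsilon>)))" by (rule finite_set_seeds)
    show "valid_queries d (tester d s)" for s by (rule valid_tester)
    fix A assume A: "A \<in> symmetric_mats d"
    note carrier = carrier_A[OF A] and sym = entries_symmetric[OF A]
    let ?F = "frob2 d (entries A)"
    show "real (num_queries A (tester d s)) \<le> 10 ^ 9 * (1 / \<epsilon>\<^sup>2) * ln (1 / \<epsilon>) powr 2"
      if "s \<in> set_pmf (seeds d (rounds \<epsilon>))" for s
    proof -
      obtain zs gs ws where s: "s = (zs, gs, ws)" by (cases s)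
      show ?thesis
        using set_seeds[OF that[unfolded s]] rounds_bound(3)[OF \<epsilon>]
        unfolding s num_queries_tester[OF carrier] by simp
    qed
    show "measure_pmf.prob (seeds d (rounds \<epsilon>)) {s. \<not> accepts A (tester d s)} \<le> 1 / 3" if "psd A"
    proof -
      have "measure_pmf.prob (seeds d (rounds \<epsilon>)) {s. accepts A (tester d s) \<noteq> True} \<le> 1 / 3"
      proof (rule prob_tester_wrong[OF carrier, where good = "\<lambda>B. B \<le> 20 * ?F"])
        fix f assume f: "\<bar>f - ?F\<bar> \<le> ?F / 2"
        then have "0 \<le> f" using frob2_nonneg[of d "entries A"] by linarith
        then have step: "0 \<le> step f (rounds \<epsilon>)" by (rule step_nonneg)
        show "measure_pmf.prob (replicate_pmf (rounds \<epsilon>) (signs d))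
            {gs. \<not> frob2 d (walk_mat d (entries A) (step f (rounds \<epsilon>)) gs) \<le> 20 * ?F} \<le> 1 / 10"
          by (rule prob_walk_psd)
             (fact sym step psd_ip_nonneg[OF that carrier] step_small[OF f frob2_nonneg])+
      next
        fix e f B
        assume "B \<le> 20 * ?F" "\<bar>e - B\<bar> \<le> B / 2" "\<bar>f - ?F\<bar> \<le> ?F / 2"
        \<comment> \<open>The chain is
          \<open>e \<le> 3 / 2 * B \<le> 30 * ?F \<le> 60 * f\<close>.\<close>
        then show "(e \<le> 60 * f) = True"
          unfolding abs_le_iff by simp
      qed
      then show ?thesis by simp
    qed
    show "measure_pmf.prob (seeds d (rounds \<epsilon>)) {s. accepts A (tester d s)} \<le> 1 / 3"
      if "A \<noteq> 0\<^sub>m d d" and far: "lambda_min A \<le> - \<epsilon> * schatten_norm 2 A"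
    proof -
      have F: "0 < ?F"
      proof (rule ccontr)
        assume "\<not> 0 < ?F"
        then have "?F = 0" using frob2_nonneg[of d "entries A"] by simp
        then have "\<forall>i<d. \<forall>j<d. A $$ (i, j) = 0"
          by (simp add: frob2_def sum_nonneg_eq_0_iff sum_nonneg)
        then have "A = 0\<^sub>m d d" using carrier by (intro eq_matI) simp_all
        with \<open>A \<noteq> 0\<^sub>m d d\<close> show False by simp
      qed
      define l where "l = - lambda_min A"
      have l: "\<epsilon> * sqrt ?F \<le> l" using far unfolding schatten_norm_2_eq[OF A] l_def by simp
      moreover have "0 \<le> \<epsilon> * sqrt ?F" using \<epsilon> F by simp
      ultimately have l0: "0 \<le> l" by (rule order.trans[rotated])
      have "0 < d" and l_eq: "lambda_min A = - l" using d by (simp_all add: l_def)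
      obtain v where v: "ip d v v = 1" "\<And>i. i < d \<Longrightarrow> mv d (entries A) v i = - l * v i"
        and lower: "\<And>y. - l * ip d y y \<le> ip d y (mv d (entries A) y)"
        using lambda_min_eigenvector[OF A \<open>0 < d\<close>, unfolded l_eq] by metis
      have "measure_pmf.prob (seeds d (rounds \<epsilon>)) {s. accepts A (tester d s) \<noteq> False} \<le> 1 / 3"
      proof (rule prob_tester_wrong[OF carrier, where good = "\<lambda>B. 180 * ?F < B"])
        fix f assume f: "\<bar>f - ?F\<bar> \<le> ?F / 2"
        then have "0 \<le> f" using frob2_nonneg[of d "entries A"] by linarith
        then have step: "0 \<le> step f (rounds \<epsilon>)" by (rule step_nonneg)
        show "measure_pmf.prob (replicate_pmf (rounds \<epsilon>) (signs d))
            {gs. \<not> 180 * ?F < frob2 d (walk_mat d (entries A) (step f (rounds \<epsilon>)) gs)} \<le> 1 / 10"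
          by (rule prob_walk_negative)
             (fact sym step l0 lower v step_small[OF f frob2_nonneg]
                step_large[OF f F rounds_bound(2)[OF \<epsilon>] \<epsilon> l rounds_bound(1)[OF \<epsilon>]])+
      next
        fix e f B
        assume "180 * ?F < B" "\<bar>e - B\<bar> \<le> B / 2" "\<bar>f - ?F\<bar> \<le> ?F / 2"
        \<comment> \<open>The chain is \<open>e \<ge> B / 2 > 90 * ?F \<ge> 60 * f\<close>.\<close>
        then show "(e \<le> 60 * f) = False"
          unfolding abs_le_iff by simp
      qed
      then show ?thesis by simp
    qed
  qed
  then show ?thesis
    by (intro exI[of _ "10 ^ 9"] exI[of _ 2] conjI allI impI) simp_all
qed

end
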